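(* Let $C$ be a coalgebra over a field $\mathbb{K}$ with comultiplication $\Delta$ and coradical filtration $C_0\subseteq C_1\subseteq C_2\subseteq\cdots$. Let $x\in C$ be such that $lw(x)>n$ (equivalently, $x\notin C_{n-1}$), and let $\Delta(x)=\sum_{i=1}^t a_i\otimes b_i$ with $a_i,b_i\in C$. Then for each integer $k$ with $1\le k\le n$, there is some $i\in\{1,\dots,t\}$ such that $lw(a_i)\ge k$ and $lw(b_i)\ge n-k$.
   Context: The coradical filtration of $C$: $C_0$ is the socle of $C$ as a left $C^*$-module (equivalently, as a right $C^*$-module; equivalently, the sum of all simple subcoalgebras of $C$), and inductively $C_n$ is such that $C_n/C_{n-1}$ is the socle of $C/C_{n-1}$ as a left (equivalently right) $C^*$-module. Here $C^*$ acts on $C$ by $c^*\cdot x=\sum x_1c^*(x_2)$ and $x\cdot c^*=\sum c^*(x_1)x_2$, where $\Delta(x)=\sum x_1\otimes x_2$. One has $\bigcup_n C_n=C$, and we put $C_{-1}=0$. For $x\in C$, $lw(x)$ denotes the Loewy length of the finite dimensional subcoalgebra $C^*\cdot x\cdot C^*$ generated by $x$; it equals the Loewy length of $C^*\cdot x$ and of $x\cdot C^*$. Concretely, $lw(x)=n+1$ if and only if $x\in C_n\setminus C_{n-1}$ ($n\ge 0$), and $lw(0)=0$. *)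

theory Defs
  imports Complex_Main "HOL-Algebra.Module" "HOL-Algebra.AbelCoset" "HOL-Algebra.Generated_Groups"
    "HOL-Library.Poly_Mapping"
begin

section \<open>Tensor products of a vector space with itself\<close>

text \<open>
  For a vector space \<open>V\<close> over \<open>'k\<close>, with underlying type \<open>'c\<close> and scalar multiplication \<open>s\<close>, the
  tensor powers \<open>V \<otimes> V\<close> and \<open>V \<otimes> V \<otimes> V\<close> are realised as the free vector space on pairs (triples)
  modulo the span of the multilinearity relations; a tensor is a coset.
\<close>

abbreviation free_scale :: "'k::field \<Rightarrow> ('x \<Rightarrow>\<^sub>0 'k) \<Rightarrow> ('x \<Rightarrow>\<^sub>0 'k)" where
  "free_scale c \<equiv> Poly_Mapping.map ((*) c)"

abbreviation pure2 :: "'c \<Rightarrow> 'c \<Rightarrow> ('c \<times> 'c) \<Rightarrow>\<^sub>0 'k::field" where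
  "pure2 a b \<equiv> Poly_Mapping.single (a, b) 1"

abbreviation pure3 :: "'c \<Rightarrow> 'c \<Rightarrow> 'c \<Rightarrow> ('c \<times> 'c \<times> 'c) \<Rightarrow>\<^sub>0 'k::field" where
  "pure3 a b c \<equiv> Poly_Mapping.single (a, b, c) 1"

text \<open>
  The relations expressing linearity in one slot; \<open>e\<close> inserts a vector into that slot, the other
  slots being fixed.
\<close>

definition slot_relations ::
    "('k::field \<Rightarrow> 'c::ab_group_add \<Rightarrow> 'c) \<Rightarrow> ('c \<Rightarrow> 'x) \<Rightarrow> ('x \<Rightarrow>\<^sub>0 'k) set" where
  "slot_relations s e =
     {Poly_Mapping.single (e (y + z)) 1 - Poly_Mapping.single (e y) 1
        - Poly_Mapping.single (e z) 1 | y z. True} \<union>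
     {Poly_Mapping.single (e (s c y)) 1 - Poly_Mapping.single (e y) c | c y. True}"

definition null2 :: "('k::field \<Rightarrow> 'c::ab_group_add \<Rightarrow> 'c) \<Rightarrow> (('c \<times> 'c) \<Rightarrow>\<^sub>0 'k) set" where
  "null2 s = Modules.module.span free_scale
     ((\<Union>b. slot_relations s (\<lambda>z. (z, b))) \<union> (\<Union>a. slot_relations s (\<lambda>z. (a, z))))"

definition null3 :: "('k::field \<Rightarrow> 'c::ab_group_add \<Rightarrow> 'c) \<Rightarrow> (('c \<times> 'c \<times> 'c) \<Rightarrow>\<^sub>0 'k) set" where
  "null3 s = Modules.module.span free_scale
     ((\<Union>b c. slot_relations s (\<lambda>z. (z, b, c))) \<union>
      (\<Union>a c. slot_relations s (\<lambda>z. (a, z, c))) \<union>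
      (\<Union>a b. slot_relations s (\<lambda>z. (a, b, z))))"

definition tensor2 ::
    "('k::field \<Rightarrow> 'c::ab_group_add \<Rightarrow> 'c) \<Rightarrow> (('c \<times> 'c) \<Rightarrow>\<^sub>0 'k) \<Rightarrow> (('c \<times> 'c) \<Rightarrow>\<^sub>0 'k) set" where
  "tensor2 s u = {v. v - u \<in> null2 s}"

definition tensor3 ::
    "('k::field \<Rightarrow> 'c::ab_group_add \<Rightarrow> 'c) \<Rightarrow> (('c \<times> 'c \<times> 'c) \<Rightarrow>\<^sub>0 'k)
       \<Rightarrow> (('c \<times> 'c \<times> 'c) \<Rightarrow>\<^sub>0 'k) set" where
  "tensor3 s u = {v. v - u \<in> null3 s}"

text \<open>
  The linear map \<open>V \<otimes> V \<rightarrow> W\<close> induced by a bilinear \<open>\<phi>\<close>, where \<open>r\<close> is the scalar multiplication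
  of \<open>W\<close>. The image of a coset is a singleton because the linear extension of \<open>\<phi>\<close> vanishes on the
  relations.
\<close>

definition tensor_lift ::
    "('k::field \<Rightarrow> 'w::ab_group_add \<Rightarrow> 'w) \<Rightarrow> ('c \<Rightarrow> 'c \<Rightarrow> 'w) \<Rightarrow> (('c \<times> 'c) \<Rightarrow>\<^sub>0 'k) set \<Rightarrow> 'w" where
  "tensor_lift r \<phi> X =
     the_elem ((\<lambda>u. \<Sum>(a, b)\<in>Poly_Mapping.keys u. r (Poly_Mapping.lookup u (a, b)) (\<phi> a b)) ` X)"


section \<open>Socle series and Loewy length\<close>

text \<open>
  The locale \<open>module\<close> of HOL-Algebra is restricted to commutative rings, whereas the ring acting
  below is the dual algebra of a coalgebra. Only the record type and the (ring-agnostic) notion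
  \<open>submodule\<close> are reused. The fields \<open>mult\<close> and \<open>one\<close> of a module record carry no meaning.
\<close>

definition simple_module :: "('r, 'a) ring_scheme \<Rightarrow> ('r, 'm, 'b) module_scheme \<Rightarrow> bool" where
  "simple_module R M \<longleftrightarrow> carrier M \<noteq> {\<zero>\<^bsub>M\<^esub>} \<and>
     (\<forall>N. submodule N R M \<longrightarrow> N = {\<zero>\<^bsub>M\<^esub>} \<or> N = carrier M)"

definition socle :: "('r, 'a) ring_scheme \<Rightarrow> ('r, 'm, 'b) module_scheme \<Rightarrow> 'm set" where
  "socle R M = generate (add_monoid M)
     (\<Union>{S. submodule S R M \<and> simple_module R (M\<lparr>carrier := S\<rparr>)})"

definition quotient_module :: "('r, 'm, 'b) module_scheme \<Rightarrow> 'm set \<Rightarrow> ('r, 'm set) module" where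
  "quotient_module M N =
     \<lparr>carrier = a_rcosets\<^bsub>M\<^esub> N, mult = undefined, one = undefined, zero = N,
      add = set_add M, smult = (\<lambda>r X. \<Union>x\<in>X. N +>\<^bsub>M\<^esub> (r \<odot>\<^bsub>M\<^esub> x))\<rparr>"

primrec socle_series ::
    "('r, 'a) ring_scheme \<Rightarrow> ('r, 'm, 'b) module_scheme \<Rightarrow> nat \<Rightarrow> 'm set" where
  "socle_series R M 0 = {\<zero>\<^bsub>M\<^esub>}"
| "socle_series R M (Suc n) =
     {x \<in> carrier M. socle_series R M n +>\<^bsub>M\<^esub> x
                       \<in> socle R (quotient_module M (socle_series R M n))}"

text \<open>Only meaningful if the socle series reaches the whole module after finitely many steps.\<close>

definition loewy_length :: "('r, 'a) ring_scheme \<Rightarrow> ('r, 'm, 'b) module_scheme \<Rightarrow> nat" where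
  "loewy_length R M = (LEAST n. socle_series R M n = carrier M)"


section \<open>Coalgebras\<close>

text \<open>
  Coassociativity \<open>(\<Delta> \<otimes> id) \<circ> \<Delta> = (id \<otimes> \<Delta>) \<circ> \<Delta>\<close> is spelled out on representations as sums of pure
  tensors; every element of \<open>C \<otimes> C\<close> has such a representation.
\<close>

locale coalgebra = vector_space scale
  for scale :: "'k::field \<Rightarrow> 'c::ab_group_add \<Rightarrow> 'c" +
  fixes comult :: "'c \<Rightarrow> (('c \<times> 'c) \<Rightarrow>\<^sub>0 'k) set"
    and counit :: "'c \<Rightarrow> 'k"
  assumes comult_tensor: "comult x \<in> range (tensor2 scale)"
    and comult_add: "\<lbrakk>u \<in> comult x; v \<in> comult y\<rbrakk> \<Longrightarrow> u + v \<in> comult (x + y)"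
    and comult_scale: "u \<in> comult x \<Longrightarrow> free_scale c u \<in> comult (scale c x)"
    and coassoc: "\<And>x (m::nat) (p::nat \<Rightarrow> nat) (q::nat \<Rightarrow> nat) a b a1 a2 b1 b2.
       \<lbrakk>comult x = tensor2 scale (\<Sum>i<m. pure2 (a i) (b i));
        \<And>i. i < m \<Longrightarrow> comult (a i) = tensor2 scale (\<Sum>j<p i. pure2 (a1 i j) (a2 i j));
        \<And>i. i < m \<Longrightarrow> comult (b i) = tensor2 scale (\<Sum>j<q i. pure2 (b1 i j) (b2 i j))\<rbrakk>
       \<Longrightarrow> tensor3 scale (\<Sum>i<m. \<Sum>j<p i. pure3 (a1 i j) (a2 i j) (b i)) =
           tensor3 scale (\<Sum>i<m. \<Sum>j<q i. pure3 (a i) (b1 i j) (b2 i j))"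
    and counit_linear: "Vector_Spaces.linear scale (*) counit"
    and counit_left: "tensor_lift scale (\<lambda>a b. scale (counit a) b) (comult x) = x"
    and counit_right: "tensor_lift scale (\<lambda>a b. scale (counit b) a) (comult x) = x"
begin

definition dual_algebra :: "('c \<Rightarrow> 'k) ring" where
  "dual_algebra =
     \<lparr>carrier = {f. Vector_Spaces.linear scale (*) f},
      mult = (\<lambda>f g x. tensor_lift (*) (\<lambda>a b. f a * g b) (comult x)),
      one = counit,
      zero = (\<lambda>x. 0),
      add = (\<lambda>f g x. f x + g x)\<rparr>"

definition left_act :: "('c \<Rightarrow> 'k) \<Rightarrow> 'c \<Rightarrow> 'c" where
  "left_act f x = tensor_lift scale (\<lambda>a b. scale (f b) a) (comult x)"

definition right_act :: "'c \<Rightarrow> ('c \<Rightarrow> 'k) \<Rightarrow> 'c" where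
  "right_act x f = tensor_lift scale (\<lambda>a b. scale (f a) b) (comult x)"

definition dual_module :: "('c \<Rightarrow> 'k, 'c) module" where
  "dual_module =
     \<lparr>carrier = UNIV, mult = undefined, one = undefined, zero = 0, add = (+), smult = left_act\<rparr>"

text \<open>
  The socle series is indexed from \<open>{0} = C\<^bsub>-1\<^esub>\<close>, hence the shift by one; below, \<open>lw x = n + 1\<close>
  iff \<open>x \<in> C\<^bsub>n\<^esub> - C\<^bsub>n-1\<^esub>\<close>.
\<close>

definition coradical_filtration :: "nat \<Rightarrow> 'c set" where
  "coradical_filtration n = socle_series dual_algebra dual_module (Suc n)"

text \<open>The subcoalgebra \<open>C\<^sup>* \<cdot> x \<cdot> C\<^sup>*\<close>.\<close>

definition generated_subcoalgebra :: "'c \<Rightarrow> 'c set" where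
  "generated_subcoalgebra x =
     span {left_act f (right_act x g) | f g. f \<in> carrier dual_algebra \<and> g \<in> carrier dual_algebra}"

definition lw :: "'c \<Rightarrow> nat" where
  "lw x = loewy_length dual_algebra (dual_module\<lparr>carrier := generated_subcoalgebra x\<rparr>)"

end

end

theory Submission
  imports Defs
begin

text \<open>
  Write \<open>S n\<close> for \<open>C\<^bsub>n-1\<^esub>\<close>, so \<open>S 0 = {0}\<close> and \<open>lw x \<le> n\<close> means \<open>x \<in> S n\<close>. If no index were as
  required, then \<open>a i \<in> S (k - 1)\<close> or \<open>b i \<in> S (n - k - 1)\<close> for every \<open>i\<close>, so
  \<open>\<Delta> x \<in> S (k - 1) \<otimes> C + C \<otimes> S (n - k - 1)\<close>. The theorem therefore follows from the wedge property
  of the coradical filtration: \<open>\<Delta> x \<in> S p \<otimes> C + C \<otimes> S q\<close> implies \<open>x \<in> S (p + q)\<close>.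

  The wedge property is easy once the filtration is described through annihilators. Let \<open>J\<close> be the set
  of functionals vanishing on the coradical \<open>S 1\<close>. Then \<open>S (n + 1) = {x. J \<cdot> x \<subseteq> S n}\<close>. The hypothesis on
  \<open>\<Delta> x\<close> says that \<open>h \<cdot> x \<in> S p\<close> for every functional \<open>h\<close> vanishing on \<open>S q\<close>; for \<open>f \<in> J\<close> and \<open>h\<close>
  vanishing on \<open>S q\<close>, the functional \<open>y \<mapsto> h (f \<cdot> y)\<close> vanishes on \<open>S (q + 1)\<close> and acts as \<open>h\<close> after \<open>f\<close>,
  which gives an induction on \<open>q\<close> (\<open>wedge_of_layers\<close>).

  The work lies in the annihilator description, in the relative form: for left submodules \<open>Z \<subseteq> D\<close> of
  \<open>C\<close>, an element \<open>x\<close> of \<open>D\<close> lies over the socle of \<open>D/Z\<close> iff \<open>J \<cdot> x \<subseteq> Z\<close>. The key is the identity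
  \<open>g (f \<cdot> x) = f (x \<cdot> g)\<close> for functionals \<open>f\<close>, \<open>g\<close>. Right multiplication by a functional \<open>g\<close> vanishing on
  \<open>Z\<close> is a left module map \<open>C/Z \<rightarrow> C\<close>, and these maps jointly separate the points of \<open>C/Z\<close>. They send
  simple submodules of \<open>C/Z\<close> into the coradical, where \<open>J\<close> vanishes, so \<open>J\<close> annihilates the socle of
  \<open>C/Z\<close> (\<open>annihilator_cover\<close>). Conversely, if \<open>J \<cdot> x \<subseteq> Z\<close>, then each \<open>x \<cdot> g\<close> lies in the coradical; the
  finite-dimensional module generated by \<open>x\<close> modulo \<open>Z\<close> is separated by maps into a semisimple module,
  and is hence semisimple (\<open>mem_relative_socle\<close>). In particular the socle series of \<open>D\<close> is \<open>D \<inter> S n\<close>.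
  Since each \<open>S n\<close> is stable under both actions, \<open>lw x \<le> n\<close> indeed means \<open>x \<in> S n\<close> (\<open>lw_le_iff\<close>).
\<close>

section \<open>Linear maps out of tensor products\<close>

lemma lookup_free_scale:
  "Poly_Mapping.lookup (free_scale c u) k = c * Poly_Mapping.lookup u k"
  for c :: "'k::field"
  by (simp add: Poly_Mapping.map.rep_eq when_def)

lemma free_scale_vector_space: "vector_space (free_scale :: 'k::field \<Rightarrow> ('x \<Rightarrow>\<^sub>0 'k) \<Rightarrow> _)"
  by unfold_locales
    (auto intro!: poly_mapping_eqI simp: lookup_add lookup_free_scale algebra_simps)

definition (in vector_space) linear_extension :: "('x \<Rightarrow> 'b) \<Rightarrow> ('x \<Rightarrow>\<^sub>0 'a) \<Rightarrow> 'b" where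
  "linear_extension \<phi> u = (\<Sum>k\<in>Poly_Mapping.keys u. scale (Poly_Mapping.lookup u k) (\<phi> k))"

lemma (in vector_space) linear_extension_superset:
  fixes u :: "'x \<Rightarrow>\<^sub>0 'a"
  assumes "finite S" "Poly_Mapping.keys u \<subseteq> S"
  shows "linear_extension \<phi> u = (\<Sum>k\<in>S. scale (Poly_Mapping.lookup u k) (\<phi> k))"
  unfolding linear_extension_def using assms
  by (intro sum.mono_neutral_left) (auto simp: in_keys_iff)

lemma (in vector_space) linear_extension_single:
  "linear_extension \<phi> (Poly_Mapping.single k c) = scale c (\<phi> k)"
  by (simp add: linear_extension_superset[of "{k}"])

lemma (in vector_space) linear_extension_add:
  "linear_extension \<phi> (u + v) = linear_extension \<phi> u + linear_extension \<phi> v"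
  using keys_add[of u v]
  by (simp add: linear_extension_superset[of "Poly_Mapping.keys u \<union> Poly_Mapping.keys v"]
      lookup_add scale_left_distrib sum.distrib)

lemma (in vector_space) linear_extension_scale:
  "linear_extension \<phi> (free_scale c u) = scale c (linear_extension \<phi> u)"
proof -
  have "Poly_Mapping.keys (free_scale c u) \<subseteq> Poly_Mapping.keys u"
    by (auto simp: in_keys_iff lookup_free_scale)
  then show ?thesis
    by (simp add: linear_extension_superset[of "Poly_Mapping.keys u"] lookup_free_scale scale_sum_right)
qed

lemma (in vector_space) linear_linear_extension:
  "Vector_Spaces.linear free_scale scale (linear_extension \<phi>)"
  using free_scale_vector_space vector_space_axioms
  by (simp add: Vector_Spaces.linear_iff linear_extension_add linear_extension_scale)

lemma (in vector_space) linear_extension_diff: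
  "linear_extension \<phi> (u - v) = linear_extension \<phi> u - linear_extension \<phi> v"
  using linear_linear_extension module_hom.diff module_hom_iff_linear by metis

lemma (in vector_space) linear_extension_sum:
  "linear_extension \<phi> (\<Sum>i\<in>I. u i) = (\<Sum>i\<in>I. linear_extension \<phi> (u i))"
  using linear_linear_extension module_hom.sum module_hom_iff_linear by metis

lemma (in vector_space) linear_extension_vanishes_on_span:
  assumes "u \<in> Modules.module.span free_scale R" "\<And>r. r \<in> R \<Longrightarrow> linear_extension \<phi> r = 0"
  shows "linear_extension \<phi> u = 0"
proof -
  interpret E: Vector_Spaces.linear free_scale scale "linear_extension \<phi>"
    by (rule linear_linear_extension)
  show ?thesis
    by (rule E.eq_0_on_span[OF assms(2) assms(1)])
qed

text \<open>
  Bilinear and trilinear maps descend to the tensor products because they are linear in each slot, and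
  each generator of the relations varies a single slot.
\<close>

lemma (in vector_space) linear_extension_vanishes_on_slot_relations:
  assumes "Vector_Spaces.linear scale scale (\<lambda>z. \<phi> (e z))" "u \<in> slot_relations scale e"
  shows "linear_extension \<phi> u = 0"
  using assms by (auto simp: slot_relations_def linear_extension_diff linear_extension_single Vector_Spaces.linear_iff)

lemma (in vector_space) linear_extension_eq_of_tensor3_eq:
  assumes "tensor3 scale u = tensor3 scale v"
    and "\<And>b c. Vector_Spaces.linear scale scale (\<lambda>z. \<phi> z b c)"
    and "\<And>a c. Vector_Spaces.linear scale scale (\<lambda>z. \<phi> a z c)"
    and "\<And>a b. Vector_Spaces.linear scale scale (\<lambda>z. \<phi> a b z)"
  shows "linear_extension (\<lambda>(a, b, c). \<phi> a b c) u = linear_extension (\<lambda>(a, b, c). \<phi> a b c) v"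
proof -
  interpret F: vector_space "free_scale :: 'a \<Rightarrow> ('b \<times> 'b \<times> 'b \<Rightarrow>\<^sub>0 'a) \<Rightarrow> _"
    by (rule free_scale_vector_space)
  have "u \<in> tensor3 scale u"
    by (simp add: tensor3_def null3_def F.span_zero)
  then have "u - v \<in> null3 scale"
    unfolding assms by (simp add: tensor3_def)
  then have "linear_extension (\<lambda>(a, b, c). \<phi> a b c) (u - v) = 0"
    unfolding null3_def using assms(2,3,4)
    by (elim linear_extension_vanishes_on_span)
      (auto elim!: linear_extension_vanishes_on_slot_relations[rotated])
  then show ?thesis
    by (simp add: linear_extension_diff)
qed

lemma (in vector_space) mem_tensor2_self: "u \<in> tensor2 scale u"
proof -
  interpret F: vector_space "free_scale :: 'a \<Rightarrow> ('b \<times> 'b \<Rightarrow>\<^sub>0 'a) \<Rightarrow> _"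
    by (rule free_scale_vector_space)
  show ?thesis
    by (simp add: tensor2_def null2_def F.span_zero)
qed

lemma (in vector_space) tensor2_eq_of_mem:
  assumes "v \<in> tensor2 scale u"
  shows "tensor2 scale v = tensor2 scale u"
proof -
  interpret F: vector_space "free_scale :: 'a \<Rightarrow> ('b \<times> 'b \<Rightarrow>\<^sub>0 'a) \<Rightarrow> _"
    by (rule free_scale_vector_space)
  have D: "v - u \<in> null2 scale"
    using assms by (simp add: tensor2_def)
  have "w - v \<in> null2 scale \<longleftrightarrow> w - u \<in> null2 scale" for w
    using F.span_diff[OF _ D[unfolded null2_def], of "w - u"]
      F.span_add[OF _ D[unfolded null2_def], of "w - v"]
    by (auto simp: null2_def)
  then show ?thesis
    by (simp add: tensor2_def)
qed

lemma (in vector_space) tensor_lift_tensor2: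
  assumes "\<And>b. Vector_Spaces.linear scale scale (\<lambda>z. \<phi> z b)"
    and "\<And>a. Vector_Spaces.linear scale scale (\<lambda>z. \<phi> a z)"
  shows "tensor_lift scale \<phi> (tensor2 scale u) = linear_extension (\<lambda>(a, b). \<phi> a b) u"
proof -
  have "linear_extension (\<lambda>(a, b). \<phi> a b) v = linear_extension (\<lambda>(a, b). \<phi> a b) u"
    if "v \<in> tensor2 scale u" for v
  proof -
    have "v - u \<in> null2 scale"
      using that by (simp add: tensor2_def)
    then have "linear_extension (\<lambda>(a, b). \<phi> a b) (v - u) = 0"
      unfolding null2_def using assms
      by (elim linear_extension_vanishes_on_span)
        (auto elim!: linear_extension_vanishes_on_slot_relations[rotated])
    then show ?thesis
      by (simp add: linear_extension_diff)
  qed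
  then have "linear_extension (\<lambda>(a, b). \<phi> a b) ` tensor2 scale u
      = {linear_extension (\<lambda>(a, b). \<phi> a b) u}"
    using mem_tensor2_self by blast
  moreover have "tensor_lift scale \<phi> (tensor2 scale u)
      = the_elem (linear_extension (\<lambda>(a, b). \<phi> a b) ` tensor2 scale u)"
    by (simp only: tensor_lift_def linear_extension_def[abs_def] split_def prod.collapse)
  ultimately show ?thesis
    by simp
qed

lemma (in vector_space) tensor_lift_eq_sum:
  assumes "\<And>b. Vector_Spaces.linear scale scale (\<lambda>z. \<phi> z b)"
    and "\<And>a. Vector_Spaces.linear scale scale (\<lambda>z. \<phi> a z)"
  shows "tensor_lift scale \<phi> (tensor2 scale (\<Sum>i\<in>I. pure2 (a i) (b i))) = (\<Sum>i\<in>I. \<phi> (a i) (b i))"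
  by (simp add: tensor_lift_tensor2[OF assms] linear_extension_sum linear_extension_single)

text \<open>
  The coefficient of each monomial of \<open>u\<close> is absorbed into its first factor.
\<close>

lemma (in vector_space) tensor2_is_sum_of_pure:
  obtains m :: nat and a b where "tensor2 scale u = tensor2 scale (\<Sum>i<m. pure2 (a i) (b i))"
proof -
  interpret F: vector_space "free_scale :: 'a \<Rightarrow> ('b \<times> 'b \<Rightarrow>\<^sub>0 'a) \<Rightarrow> _"
    by (rule free_scale_vector_space)
  obtain e :: "nat \<Rightarrow> 'b \<times> 'b" and m where e: "bij_betw e {..<m} (Poly_Mapping.keys u)"
    using ex_bij_betw_nat_finite[OF finite_keys[of u]] by (auto simp: atLeast0LessThan)
  define c where "c i = Poly_Mapping.lookup u (e i)" for i
  define a where "a i = scale (c i) (fst (e i))" for i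
  define b where "b i = snd (e i)" for i
  have "u = (\<Sum>k\<in>Poly_Mapping.keys u. Poly_Mapping.single k (Poly_Mapping.lookup u k))"
    by (rule poly_mapping_eqI) (simp add: lookup_sum lookup_single when_def in_keys_iff)
  also have "\<dots> = (\<Sum>i<m. Poly_Mapping.single (e i) (c i))"
    unfolding c_def using e by (rule sum.reindex_bij_betw[symmetric])
  finally have u: "u = (\<Sum>i<m. Poly_Mapping.single (e i) (c i))" .
  have "pure2 (a i) (b i) - Poly_Mapping.single (e i) (c i) \<in> null2 scale" for i
    unfolding null2_def
  proof (rule F.span_base, rule UnI1, rule UN_I[OF UNIV_I])
    show "pure2 (a i) (b i) - Poly_Mapping.single (e i) (c i) \<in> slot_relations scale (\<lambda>z. (z, b i))"
      unfolding slot_relations_def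
      by (rule UnI2) (auto simp: a_def b_def intro!: exI[of _ "c i"] exI[of _ "fst (e i)"])
  qed
  then have "(\<Sum>i<m. pure2 (a i) (b i)) - u \<in> null2 scale"
    unfolding u null2_def by (simp flip: sum_subtractf add: F.span_sum)
  then show thesis
    by (intro that tensor2_eq_of_mem[symmetric]) (simp add: tensor2_def)
qed

section \<open>Finite-dimensional subspaces\<close>

lemma (in vector_space) dim_psubset_of_finite_span:
  assumes "subspace V" "V \<subset> V'" "V' \<subseteq> span B" "finite B"
  shows "dim V < dim V'"
proof -
  obtain A where A: "A \<subseteq> V" "independent A" "V \<subseteq> span A"
    using maximal_independent_subset by blast
  obtain y where y: "y \<in> V'" "y \<notin> V"
    using assms(2) by blast
  have "span A = V"
    using A assms(1) by (simp add: span_minimal subset_antisym)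
  then have ind: "independent (insert y A)"
    using A(2) y(2) by (simp add: independent_insertI)
  have "y \<notin> A"
    using A(1) y(2) by blast
  obtain A' where A': "insert y A \<subseteq> A'" "A' \<subseteq> V'" "independent A'" "V' \<subseteq> span A'"
    using maximal_independent_subset_extend[OF _ ind, of V'] A y assms(2) by blast
  have fin: "finite A'"
    using independent_span_bound[OF assms(4) A'(3)] A'(2) assms(3) by blast
  have "card A < card A'"
    using A'(1) \<open>y \<notin> A\<close> by (intro psubset_card_mono fin) auto
  then show ?thesis
    using basis_card_eq_dim[OF A(1,3,2)] basis_card_eq_dim[OF A'(2,4,3)] by simp
qed

text \<open>
  The subspaces between \<open>Z\<close> and \<open>Z + W\<close> satisfy the descending chain condition when \<open>W\<close> is
  finite-dimensional: by the modular law, such an \<open>L\<close> equals \<open>Z + (L \<inter> W)\<close>, so \<open>dim (L \<inter> W)\<close> strictly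
  decreases along proper inclusions. Working with \<open>L \<inter> W\<close> avoids vector space quotients by \<open>Z\<close>.
\<close>

lemma (in vector_space) minimal_subspace_over:
  assumes "F \<noteq> {}"
    and F: "\<And>L. L \<in> F \<Longrightarrow> subspace L \<and> Z \<subseteq> L \<and> (\<forall>l\<in>L. \<exists>z\<in>Z. \<exists>w\<in>W. l = z + w)"
    and W: "subspace W" "W \<subseteq> span B" "finite B"
  obtains L where "L \<in> F" "\<And>L'. L' \<in> F \<Longrightarrow> L' \<subseteq> L \<Longrightarrow> L' = L"
proof -
  obtain L where L: "L \<in> F" "\<And>L'. L' \<in> F \<Longrightarrow> dim (L \<inter> W) \<le> dim (L' \<inter> W)"
    using assms(1) ex_has_least_nat[of "\<lambda>L. L \<in> F" _ "\<lambda>L. dim (L \<inter> W)"] by blast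
  have "L' = L" if L': "L' \<in> F" "L' \<subseteq> L" for L'
  proof (rule ccontr)
    assume "L' \<noteq> L"
    then obtain l where l: "l \<in> L" "l \<notin> L'"
      using L'(2) by blast
    then obtain z w where zw: "z \<in> Z" "w \<in> W" "l = z + w"
      using F[OF L(1)] by blast
    have "l - z \<in> L"
      using F[OF L(1)] l(1) zw(1) by (blast intro: subspace_diff)
    then have "w \<in> L"
      using zw(3) by simp
    moreover have "w \<notin> L'"
      using l zw F[OF L'(1)] by (auto dest: subspace_add)
    ultimately have "L' \<inter> W \<subset> L \<inter> W"
      using L'(2) zw(2) by blast
    then have "dim (L' \<inter> W) < dim (L \<inter> W)"
      using F[OF L'(1)] W by (intro dim_psubset_of_finite_span[of _ _ B] subspace_inter) auto
    then show False
      using L(2)[OF L'(1)] by simp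
  qed
  with L(1) show thesis
    by (rule that)
qed

section \<open>The two actions of the dual algebra\<close>

lemma vector_space_field: "vector_space ((*) :: 'k::field \<Rightarrow> 'k \<Rightarrow> 'k)"
  by unfold_locales (auto simp: algebra_simps)

context coalgebra
begin

abbreviation functional :: "('c \<Rightarrow> 'k) \<Rightarrow> bool" where
  "functional f \<equiv> Vector_Spaces.linear scale (*) f"

lemma functional_iff:
  "functional f \<longleftrightarrow> (\<forall>x y. f (x + y) = f x + f y) \<and> (\<forall>c x. f (scale c x) = c * f x)"
  using vector_space_axioms vector_space_field[where 'k = 'k]
  by (simp add: Vector_Spaces.linear_iff)

lemma linear_scale_iff:
  "Vector_Spaces.linear scale scale h \<longleftrightarrow>
    (\<forall>x y. h (x + y) = h x + h y) \<and> (\<forall>c x. h (scale c x) = scale c (h x))"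
  using vector_space_axioms by (simp add: Vector_Spaces.linear_iff)

lemma functional_sum:
  assumes "functional f"
  shows "f (\<Sum>i\<in>I. scale (c i) (u i)) = (\<Sum>i\<in>I. c i * f (u i))"
proof -
  interpret Vector_Spaces.linear scale "(*)" f by fact
  show ?thesis by (simp add: sum scale)
qed

lemma functional_diff: "functional f \<Longrightarrow> f (x - y) = f x - f y"
  using module_hom.diff module_hom_iff_linear by metis

lemma functional_0: "functional f \<Longrightarrow> f 0 = 0"
  using functional_diff[of f 0 0] by simp

lemma functional_comp:
  "functional g \<Longrightarrow> Vector_Spaces.linear scale scale h \<Longrightarrow> functional (\<lambda>y. g (h y))"
  by (simp add: functional_iff linear_scale_iff)

lemma functional_scale: "functional f \<Longrightarrow> functional (\<lambda>y. c * f y)"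
  by (simp add: functional_iff algebra_simps)

lemma separating_functional:
  assumes "subspace Z" "y \<notin> Z"
  obtains f where "functional f" "\<And>z. z \<in> Z \<Longrightarrow> f z = 0" "f y \<noteq> 0"
proof -
  interpret P: vector_space_pair scale "(*) :: 'k \<Rightarrow> 'k \<Rightarrow> 'k"
    by (intro vector_space_pair.intro vector_space_axioms vector_space_field)
  obtain B where B: "B \<subseteq> Z" "independent B" "Z \<subseteq> span B"
    using maximal_independent_subset by blast
  have "span B = Z"
    using B assms(1) by (simp add: span_minimal subset_antisym)
  then have "independent (insert y B)" "y \<notin> B"
    using B assms(2) independent_insertI by auto
  then obtain f where f: "functional f" "\<forall>x\<in>insert y B. f x = (if x = y then 1 else 0)"
    using P.linear_independent_extend[of "insert y B" "\<lambda>x. if x = y then 1 else 0"] by blast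
  interpret f: Vector_Spaces.linear scale "(*)" f by fact
  have "f z = 0" if "z \<in> Z" for z
    using f.eq_0_on_span[of B z] f(2) \<open>y \<notin> B\<close> that \<open>span B = Z\<close> by (metis insertCI)
  with f show thesis
    by (intro that[of f]) auto
qed

text \<open>
  A subspace is the common kernel of the functionals vanishing on it. Membership claims below are
  reduced to the identity \<open>g (f \<cdot> x) = f (x \<cdot> g)\<close> in this way.
\<close>

lemma mem_subspaceI:
  assumes "subspace Z" "\<And>f. functional f \<Longrightarrow> (\<And>z. z \<in> Z \<Longrightarrow> f z = 0) \<Longrightarrow> f y = 0"
  shows "y \<in> Z"
  using separating_functional[OF assms(1)] assms(2) by metis

lemma comult_eq_sum:
  obtains m :: nat and a b where "comult x = tensor2 scale (\<Sum>i<m. pure2 (a i) (b i))"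
proof -
  obtain u where "comult x = tensor2 scale u"
    using comult_tensor[of x] by blast
  then show thesis
    using that by (metis tensor2_is_sum_of_pure[of u])
qed

lemma left_act_eq_sum:
  assumes "functional f" "comult x = tensor2 scale (\<Sum>i\<in>I. pure2 (a i) (b i))"
  shows "left_act f x = (\<Sum>i\<in>I. scale (f (b i)) (a i))"
  unfolding left_act_def assms(2) using assms(1)
  by (intro tensor_lift_eq_sum) (auto simp: linear_scale_iff functional_iff scale_right_distrib
      scale_left_distrib scale_left_commute)

lemma right_act_eq_sum:
  assumes "functional f" "comult x = tensor2 scale (\<Sum>i\<in>I. pure2 (a i) (b i))"
  shows "right_act x f = (\<Sum>i\<in>I. scale (f (a i)) (b i))"
  unfolding right_act_def assms(2) using assms(1)
  by (intro tensor_lift_eq_sum) (auto simp: linear_scale_iff functional_iff scale_right_distrib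
      scale_left_distrib scale_left_commute)

lemma left_act_counit: "left_act counit x = x"
  using counit_right unfolding left_act_def .

lemma right_act_counit: "right_act x counit = x"
  using counit_left unfolding right_act_def .

lemma left_act_add_functional:
  assumes "functional f" "functional g"
  shows "left_act (\<lambda>y. f y + g y) x = left_act f x + left_act g x"
proof -
  obtain m :: nat and a b where D: "comult x = tensor2 scale (\<Sum>i<m. pure2 (a i) (b i))"
    by (rule comult_eq_sum)
  have "functional (\<lambda>y. f y + g y)"
    using assms by (simp add: functional_iff algebra_simps)
  then show ?thesis
    using assms by (simp add: left_act_eq_sum[OF _ D] scale_left_distrib sum.distrib)
qed

lemma left_act_scale_functional:
  assumes "functional f"
  shows "left_act (\<lambda>y. c * f y) x = scale c (left_act f x)"
proof -
  obtain m :: nat and a b where D: "comult x = tensor2 scale (\<Sum>i<m. pure2 (a i) (b i))"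
    by (rule comult_eq_sum)
  show ?thesis
    using assms by (simp add: left_act_eq_sum[OF _ D] functional_scale scale_sum_right)
qed

text \<open>
  Both sides are \<open>\<Sum> g x\<^sub>1 f x\<^sub>2\<close>. This exchanges statements about the left action modulo a submodule for
  statements about right translates, which live in \<open>C\<close> itself.
\<close>

lemma functional_left_act:
  assumes "functional f" "functional g"
  shows "g (left_act f x) = f (right_act x g)"
proof -
  obtain m :: nat and a b where D: "comult x = tensor2 scale (\<Sum>i<m. pure2 (a i) (b i))"
    by (rule comult_eq_sum)
  show ?thesis
    using assms
    by (simp add: left_act_eq_sum[OF _ D] right_act_eq_sum[OF _ D]
        functional_sum[OF assms(1)] functional_sum[OF assms(2)] mult.commute)
qed

lemma tensor_lift_comult_linear:
  assumes "\<And>b. Vector_Spaces.linear scale scale (\<lambda>z. \<phi> z b)"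
    and "\<And>a. Vector_Spaces.linear scale scale (\<lambda>z. \<phi> a z)"
  shows "Vector_Spaces.linear scale scale (\<lambda>x. tensor_lift scale \<phi> (comult x))"
proof -
  have ex: "tensor_lift scale \<phi> (comult x) = linear_extension (\<lambda>(a, b). \<phi> a b) u" if "u \<in> comult x" for x u
  proof -
    obtain v where v: "comult x = tensor2 scale v"
      using comult_tensor[of x] by auto
    show ?thesis
      using tensor_lift_tensor2[OF assms, where u=u] that tensor2_eq_of_mem[of u v] v by simp
  qed
  have ne: "\<exists>u. u \<in> comult x" for x
    using comult_tensor[of x] mem_tensor2_self by (metis imageE)
  have "tensor_lift scale \<phi> (comult (x + y))
      = tensor_lift scale \<phi> (comult x) + tensor_lift scale \<phi> (comult y)" for x y
  proof -
    obtain u v where "u \<in> comult x" "v \<in> comult y"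
      using ne by metis
    then show ?thesis
      using ex[OF comult_add[of u x v y]] ex[of u x] ex[of v y] by (simp add: linear_extension_add)
  qed
  moreover have "tensor_lift scale \<phi> (comult (scale c x)) = scale c (tensor_lift scale \<phi> (comult x))" for c x
  proof -
    obtain u where "u \<in> comult x"
      using ne by metis
    then show ?thesis
      using ex[OF comult_scale[of u x c]] ex[of u x] by (simp add: linear_extension_scale)
  qed
  ultimately show ?thesis
    by (simp add: linear_scale_iff)
qed

lemma linear_left_act:
  assumes "functional f"
  shows "Vector_Spaces.linear scale scale (left_act f)"
  unfolding left_act_def[abs_def] using assms
  by (intro tensor_lift_comult_linear) (auto simp: linear_scale_iff functional_iff scale_right_distrib
      scale_left_distrib scale_left_commute)

lemma linear_right_act:
  assumes "functional f"
  shows "Vector_Spaces.linear scale scale (\<lambda>x. right_act x f)"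
  unfolding right_act_def[abs_def] using assms
  by (intro tensor_lift_comult_linear) (auto simp: linear_scale_iff functional_iff scale_right_distrib
      scale_left_distrib scale_left_commute)

text \<open>
  Coassociativity for one coherent choice of representations of the comultiplication, in a form to
  which trilinear maps can be applied.
\<close>

lemma iterated_comult:
  obtains a b and m :: nat and a1 a2 and p :: "nat \<Rightarrow> nat" and b1 b2 and q :: "nat \<Rightarrow> nat"
  where "comult x = tensor2 scale (\<Sum>i<m. pure2 (a i) (b i))"
    and "\<And>i. comult (a i) = tensor2 scale (\<Sum>j<p i. pure2 (a1 i j) (a2 i j))"
    and "\<And>i. comult (b i) = tensor2 scale (\<Sum>j<q i. pure2 (b1 i j) (b2 i j))"
    and "tensor3 scale (\<Sum>i<m. \<Sum>j<p i. pure3 (a1 i j) (a2 i j) (b i))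
       = tensor3 scale (\<Sum>i<m. \<Sum>j<q i. pure3 (a i) (b1 i j) (b2 i j))"
proof -
  obtain N :: "'c \<Rightarrow> nat" and A B
    where D: "comult y = tensor2 scale (\<Sum>j<N y. pure2 (A y j) (B y j))" for y
  proof -
    define P where "P y r \<longleftrightarrow> comult y = tensor2 scale (\<Sum>j<fst r. pure2 (fst (snd r) j) (snd (snd r) j))"
      for y :: 'c and r :: "nat \<times> (nat \<Rightarrow> 'c) \<times> (nat \<Rightarrow> 'c)"
    have "\<exists>r. P y r" for y
    proof -
      obtain m :: nat and a b where "comult y = tensor2 scale (\<Sum>i<m. pure2 (a i) (b i))"
        by (rule comult_eq_sum)
      then have "P y (m, a, b)"
        by (simp add: P_def)
      then show ?thesis ..
    qed
    then have "P y (Eps (P y))" for y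
      by (rule someI_ex)
    then show thesis
      unfolding P_def by (rule that)
  qed
  show thesis
    by (rule that[OF D D D coassoc[OF D D D]])
qed

lemma left_act_sum:
  assumes "functional f"
  shows "left_act f (\<Sum>i\<in>I. scale (c i) (u i)) = (\<Sum>i\<in>I. scale (c i) (left_act f (u i)))"
proof -
  interpret Vector_Spaces.linear scale scale "left_act f" by (rule linear_left_act[OF assms])
  show ?thesis by (simp add: sum scale)
qed

lemma right_act_sum:
  assumes "functional f"
  shows "right_act (\<Sum>i\<in>I. scale (c i) (u i)) f = (\<Sum>i\<in>I. scale (c i) (right_act (u i) f))"
proof -
  interpret Vector_Spaces.linear scale scale "\<lambda>x. right_act x f" by (rule linear_right_act[OF assms])
  show ?thesis by (simp add: sum scale)
qed

text \<open>
  Both sides are \<open>\<Sum> g x\<^sub>1 f x\<^sub>3 x\<^sub>2\<close>. Hence right translations are endomorphisms of the left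
  module \<open>C\<close>.
\<close>

lemma left_act_right_act:
  assumes f: "functional f" and g: "functional g"
  shows "left_act f (right_act x g) = right_act (left_act f x) g"
proof -
  obtain a b and m :: nat and a1 a2 and p :: "nat \<Rightarrow> nat" and b1 b2 and q :: "nat \<Rightarrow> nat"
    where D: "comult x = tensor2 scale (\<Sum>i<m. pure2 (a i) (b i))"
      "\<And>i. comult (a i) = tensor2 scale (\<Sum>j<p i. pure2 (a1 i j) (a2 i j))"
      "\<And>i. comult (b i) = tensor2 scale (\<Sum>j<q i. pure2 (b1 i j) (b2 i j))"
    and T: "tensor3 scale (\<Sum>i<m. \<Sum>j<p i. pure3 (a1 i j) (a2 i j) (b i))
       = tensor3 scale (\<Sum>i<m. \<Sum>j<q i. pure3 (a i) (b1 i j) (b2 i j))"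
    by (rule iterated_comult[of x]) (rule that; assumption)
  show ?thesis
    using linear_extension_eq_of_tensor3_eq[OF T, of "\<lambda>u v w. scale (g u * f w) v"] f g
    by (simp add: linear_scale_iff functional_iff linear_extension_sum linear_extension_single
        left_act_eq_sum[OF _ D(1)] right_act_eq_sum[OF _ D(1)] left_act_eq_sum[OF _ D(3)]
        right_act_eq_sum[OF _ D(2)] left_act_sum right_act_sum scale_sum_right
        scale_right_distrib scale_left_distrib algebra_simps)
qed

text \<open>
  The functional on the right is the convolution product of \<open>g\<close> and \<open>f\<close>. Writing it as \<open>g\<close> after the
  action of \<open>f\<close> makes both its linearity and its zeros visible.
\<close>

lemma left_act_left_act:
  assumes f: "functional f" and g: "functional g"
  shows "left_act g (left_act f x) = left_act (\<lambda>y. g (left_act f y)) x"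
proof -
  obtain a b and m :: nat and a1 a2 and p :: "nat \<Rightarrow> nat" and b1 b2 and q :: "nat \<Rightarrow> nat"
    where D: "comult x = tensor2 scale (\<Sum>i<m. pure2 (a i) (b i))"
      "\<And>i. comult (a i) = tensor2 scale (\<Sum>j<p i. pure2 (a1 i j) (a2 i j))"
      "\<And>i. comult (b i) = tensor2 scale (\<Sum>j<q i. pure2 (b1 i j) (b2 i j))"
    and T: "tensor3 scale (\<Sum>i<m. \<Sum>j<p i. pure3 (a1 i j) (a2 i j) (b i))
       = tensor3 scale (\<Sum>i<m. \<Sum>j<q i. pure3 (a i) (b1 i j) (b2 i j))"
    by (rule iterated_comult[of x]) (rule that; assumption)
  have gf: "functional (\<lambda>y. g (left_act f y))"
    using g linear_left_act[OF f] by (rule functional_comp)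
  show ?thesis
    using linear_extension_eq_of_tensor3_eq[OF T, of "\<lambda>u v w. scale (g v * f w) u"] f g
    by (simp add: linear_scale_iff functional_iff linear_extension_sum linear_extension_single
        left_act_eq_sum[OF _ D(1)] left_act_eq_sum[OF gf D(1)] left_act_eq_sum[OF _ D(2)]
        left_act_eq_sum[OF _ D(3)] left_act_sum functional_sum[OF g] scale_sum_left scale_sum_right
        scale_right_distrib scale_left_distrib algebra_simps)
qed

section \<open>Left submodules and relative socles\<close>

definition left_submodule :: "'c set \<Rightarrow> bool" where
  "left_submodule U \<longleftrightarrow> subspace U \<and> (\<forall>f u. functional f \<longrightarrow> u \<in> U \<longrightarrow> left_act f u \<in> U)"

lemma left_act_add: "functional f \<Longrightarrow> left_act f (x + y) = left_act f x + left_act f y"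
  using linear_left_act by (simp add: linear_scale_iff)

lemma left_act_scale: "functional f \<Longrightarrow> left_act f (scale c x) = scale c (left_act f x)"
  using linear_left_act by (simp add: linear_scale_iff)

lemma right_act_add: "functional f \<Longrightarrow> right_act (x + y) f = right_act x f + right_act y f"
  using linear_right_act by (simp add: linear_scale_iff)

lemma right_act_scale: "functional f \<Longrightarrow> right_act (scale c x) f = scale c (right_act x f)"
  using linear_right_act by (simp add: linear_scale_iff)

lemma left_act_0: "functional f \<Longrightarrow> left_act f 0 = 0"
  using left_act_scale[of f 0 0] by simp

lemma right_act_0: "functional f \<Longrightarrow> right_act 0 f = 0"
  using right_act_scale[of f 0 0] by simp

lemma left_act_diff: "functional f \<Longrightarrow> left_act f (x - y) = left_act f x - left_act f y"
  using left_act_add[of f "x - y" y] by simp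

lemma right_act_diff: "functional f \<Longrightarrow> right_act (x - y) f = right_act x f - right_act y f"
  using right_act_add[of f "x - y" y] by simp

lemma left_submodule_span:
  assumes "\<And>f u. functional f \<Longrightarrow> u \<in> G \<Longrightarrow> left_act f u \<in> span G"
  shows "left_submodule (span G)"
proof -
  have "left_act f u \<in> span G" if "functional f" "u \<in> span G" for f u
    using that(2)
  proof (induction rule: span_induct_alt)
    case base
    then show ?case by (simp add: left_act_0 that span_zero)
  next
    case (step c x y)
    then show ?case
      using assms[OF that(1)] by (simp add: left_act_add left_act_scale that span_add span_scale)
  qed
  then show ?thesis
    by (simp add: left_submodule_def)
qed

lemma left_submodule_0: "left_submodule {0}"
  by (auto simp: left_submodule_def left_act_0 subspace_single_0)

lemma left_submodule_Int: "left_submodule U \<Longrightarrow> left_submodule V \<Longrightarrow> left_submodule (U \<inter> V)"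
  by (simp add: left_submodule_def subspace_inter)

lemma left_submodule_sum:
  assumes "left_submodule U" "left_submodule V"
  shows "left_submodule {u + v |u v. u \<in> U \<and> v \<in> V}"
  unfolding left_submodule_def
proof (intro conjI allI impI)
  show "subspace {u + v |u v. u \<in> U \<and> v \<in> V}"
    using assms by (intro subspace_sums) (auto simp: left_submodule_def)
  show "left_act f w \<in> {u + v |u v. u \<in> U \<and> v \<in> V}"
    if "functional f" "w \<in> {u + v |u v. u \<in> U \<and> v \<in> V}" for f w
    using assms that by (auto simp: left_submodule_def left_act_add) blast
qed

lemma left_submodule_image_right_act:
  assumes "left_submodule U" "functional g"
  shows "left_submodule ((\<lambda>u. right_act u g) ` U)"
proof -
  have "subspace ((\<lambda>u. right_act u g) ` U)"
    using module_hom.subspace_image[of scale scale "\<lambda>u. right_act u g" U] assms linear_right_act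
    by (simp add: left_submodule_def module_hom_iff_linear)
  then show ?thesis
    using assms by (auto simp: left_submodule_def left_act_right_act)
qed

lemma left_submodule_vimage_right_act:
  assumes "left_submodule U" "left_submodule V" "functional g"
  shows "left_submodule {u \<in> U. right_act u g \<in> V}"
  using assms
  by (auto simp: left_submodule_def subspace_def right_act_0 right_act_add right_act_scale
      simp flip: left_act_right_act)

lemma left_submodule_cyclic: "left_submodule {left_act f x |f. functional f}"
proof -
  have "functional (\<lambda>y. 0)"
    by (simp add: functional_iff)
  then have "\<exists>f. 0 = left_act f x \<and> functional f"
    using left_act_scale_functional[of "\<lambda>y. 0" 0 x] by auto
  moreover have "\<exists>f. left_act g x + left_act h x = left_act f x \<and> functional f"
    if "functional g" "functional h" for g h
    using that by (intro exI[of _ "\<lambda>y. g y + h y"])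
      (auto simp: left_act_add_functional functional_iff algebra_simps)
  moreover have "\<exists>f. scale c (left_act g x) = left_act f x \<and> functional f"
    if "functional g" for g c
    using that by (intro exI[of _ "\<lambda>y. c * g y"])
      (auto simp: left_act_scale_functional functional_scale)
  moreover have "\<exists>f. left_act h (left_act g x) = left_act f x \<and> functional f"
    if "functional g" "functional h" for g h
    using that by (intro exI[of _ "\<lambda>y. h (left_act g y)"])
      (auto simp: left_act_left_act functional_comp linear_left_act)
  ultimately show ?thesis
    by (auto simp: left_submodule_def subspace_def)
qed

lemma mem_cyclic: "x \<in> {left_act f x |f. functional f}"
  using left_act_counit[of x] counit_linear by (auto intro: exI[of _ counit])

text \<open>
  If \<open>\<Delta> x = \<Sum> a\<^sub>i \<otimes> b\<^sub>i\<close>, then every \<open>f \<cdot> x = \<Sum> f b\<^sub>i a\<^sub>i\<close> is a combination of the \<open>a\<^sub>i\<close>.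
\<close>

lemma cyclic_finite_dimensional:
  obtains B where "finite B" "{left_act f x |f. functional f} \<subseteq> span B"
proof -
  obtain m :: nat and a b where D: "comult x = tensor2 scale (\<Sum>i<m. pure2 (a i) (b i))"
    by (rule comult_eq_sum)
  have "(\<Sum>i<m. scale (f (b i)) (a i)) \<in> span (a ` {..<m})" for f
    by (rule span_sum) (simp add: span_scale span_base)
  then have "{left_act f x |f. functional f} \<subseteq> span (a ` {..<m})"
    by (auto simp: left_act_eq_sum[OF _ D])
  then show thesis
    by (intro that[of "a ` {..<m}"]) auto
qed

text \<open>
  The covers of \<open>Z\<close> are the submodules \<open>U\<close> for which \<open>U/Z\<close> is simple; those of \<open>{0}\<close> are the simple
  submodules of \<open>C\<close>.
\<close>

definition covers :: "'c set \<Rightarrow> 'c set \<Rightarrow> bool" where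
  "covers Z U \<longleftrightarrow> left_submodule Z \<and> left_submodule U \<and> Z \<subset> U \<and>
     (\<forall>L. left_submodule L \<longrightarrow> Z \<subseteq> L \<longrightarrow> L \<subseteq> U \<longrightarrow> L = Z \<or> L = U)"

text \<open>
  The preimage in \<open>D\<close> of the socle of \<open>D/Z\<close>, for \<open>Z \<subseteq> D\<close>; see \<open>socle_quotient\<close>.
\<close>

definition relative_socle :: "'c set \<Rightarrow> 'c set \<Rightarrow> 'c set" where
  "relative_socle D Z = span (Z \<union> \<Union>{U. covers Z U \<and> U \<subseteq> D})"

abbreviation coradical :: "'c set" where
  "coradical \<equiv> relative_socle UNIV {0}"

definition coradical_annihilator :: "('c \<Rightarrow> 'k) set" where
  "coradical_annihilator = {f. functional f \<and> (\<forall>y\<in>coradical. f y = 0)}"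

lemma left_submodule_relative_socle:
  assumes "left_submodule Z"
  shows "left_submodule (relative_socle D Z)"
  unfolding relative_socle_def
proof (rule left_submodule_span)
  fix f u assume "functional f" "u \<in> Z \<union> \<Union>{U. covers Z U \<and> U \<subseteq> D}"
  then consider "u \<in> Z" | U where "u \<in> U" "covers Z U" "U \<subseteq> D"
    by blast
  then have "left_act f u \<in> Z \<union> \<Union>{U. covers Z U \<and> U \<subseteq> D}"
  proof cases
    case 1
    then show ?thesis
      using assms \<open>functional f\<close> by (simp add: left_submodule_def)
  next
    case 2
    then have "left_act f u \<in> U"
      using \<open>functional f\<close> by (simp add: covers_def left_submodule_def)
    with 2 show ?thesis by blast
  qed
  then show "left_act f u \<in> span (Z \<union> \<Union>{U. covers Z U \<and> U \<subseteq> D})"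
    by (rule span_base)
qed

lemma subset_relative_socle: "Z \<subseteq> relative_socle D Z"
  unfolding relative_socle_def by (simp add: span_superset le_supI1 subset_trans[OF _ span_superset])

lemma cover_subset_relative_socle: "covers Z U \<Longrightarrow> U \<subseteq> D \<Longrightarrow> U \<subseteq> relative_socle D Z"
  unfolding relative_socle_def by (rule subset_trans[OF _ span_superset]) blast

text \<open>
  \<open>f (z \<cdot> g) = g (f \<cdot> z) = 0\<close> for every functional \<open>f\<close>, because \<open>f \<cdot> z\<close> stays in \<open>Z\<close>. So right translation
  by \<open>g\<close> factors through \<open>C/Z\<close>.
\<close>

lemma right_act_eq_0:
  assumes "left_submodule Z" "functional g" "\<And>z. z \<in> Z \<Longrightarrow> g z = 0" "z \<in> Z"
  shows "right_act z g = 0"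
proof -
  have "right_act z g \<in> {0}"
    using assms functional_left_act[of _ g z]
    by (intro mem_subspaceI subspace_single_0) (metis left_submodule_def)
  then show ?thesis by simp
qed

text \<open>
  Right translation by \<open>g\<close> induces a module map from the simple module \<open>U/Z\<close> to \<open>C\<close>, whose image is
  zero or simple.
\<close>

lemma image_of_cover:
  assumes U: "covers Z U" and g: "functional g" "\<And>z. z \<in> Z \<Longrightarrow> g z = 0"
  shows "(\<lambda>u. right_act u g) ` U = {0} \<or> covers {0} ((\<lambda>u. right_act u g) ` U)"
proof -
  define V where "V = (\<lambda>u. right_act u g) ` U"
  have V: "left_submodule V"
    unfolding V_def using U g by (auto simp: covers_def intro: left_submodule_image_right_act)
  have "L = {0} \<or> L = V" if L: "left_submodule L" "L \<subseteq> V" for L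
  proof -
    define M where "M = {u \<in> U. right_act u g \<in> L}"
    have "0 \<in> L"
      using L by (auto simp: left_submodule_def subspace_0)
    then have "Z \<subseteq> M"
      using U right_act_eq_0[OF _ g] by (auto simp: M_def covers_def)
    moreover have "left_submodule M"
      unfolding M_def using U L g by (auto simp: covers_def intro: left_submodule_vimage_right_act)
    ultimately have "M = Z \<or> M = U"
      using U by (auto simp: covers_def M_def)
    moreover have "L = (\<lambda>u. right_act u g) ` M"
      using L(2) by (auto simp: M_def V_def)
    moreover have "(\<lambda>u. right_act u g) ` Z = {0}"
      using U right_act_eq_0[OF _ g] by (auto simp: covers_def left_submodule_def image_iff dest: subspace_0)
    ultimately show ?thesis
      by (auto simp: V_def)
  qed
  moreover have "V = {0} \<or> {0} \<subset> V"
    using V by (auto simp: left_submodule_def dest: subspace_0)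
  ultimately show ?thesis
    using V left_submodule_0 unfolding V_def[symmetric] covers_def by blast
qed

lemma right_act_cover_in_coradical:
  assumes "covers Z U" "functional g" "\<And>z. z \<in> Z \<Longrightarrow> g z = 0" "y \<in> U"
  shows "right_act y g \<in> coradical"
  using image_of_cover[OF assms(1-3)] cover_subset_relative_socle[of "{0}" _ UNIV]
    subset_relative_socle[of "{0}" UNIV] assms(4) by blast

text \<open>
  For \<open>g\<close> vanishing on \<open>Z\<close>, \<open>g (f \<cdot> y) = f (y \<cdot> g)\<close>, and \<open>y \<cdot> g\<close> lies in the coradical, where \<open>f\<close>
  vanishes.
\<close>

lemma annihilator_cover:
  assumes U: "covers Z U" and f: "f \<in> coradical_annihilator" and "y \<in> U"
  shows "left_act f y \<in> Z"
proof (rule mem_subspaceI)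
  show "subspace Z"
    using U by (simp add: covers_def left_submodule_def)
  fix g assume "functional g" "\<And>z. z \<in> Z \<Longrightarrow> g z = 0"
  then have "right_act y g \<in> coradical"
    using U \<open>y \<in> U\<close> by (intro right_act_cover_in_coradical)
  then show "g (left_act f y) = 0"
    using f \<open>functional g\<close> by (simp add: coradical_annihilator_def functional_left_act)
qed

lemma annihilator_relative_socle:
  assumes Z: "left_submodule Z" and f: "f \<in> coradical_annihilator" and x: "x \<in> relative_socle D Z"
  shows "left_act f x \<in> Z"
  using x unfolding relative_socle_def
proof (induction rule: span_induct_alt)
  case base
  then show ?case
    using f Z by (simp add: coradical_annihilator_def left_act_0 left_submodule_def subspace_0)
next
  case (step c x y)
  have "left_act f x \<in> Z"
    using step(1) Z f annihilator_cover
    by (auto simp: left_submodule_def coradical_annihilator_def)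
  then show ?case
    using step(2) f Z
    by (simp add: coradical_annihilator_def left_act_add left_act_scale left_submodule_def
        subspace_add subspace_scale)
qed

text \<open>
  The converse use of \<open>g (f \<cdot> x) = f (x \<cdot> g)\<close>: the coradical is the common kernel of its annihilator.
\<close>

lemma right_act_in_coradical:
  assumes "\<And>f. f \<in> coradical_annihilator \<Longrightarrow> left_act f x \<in> Z"
    and "functional g" "\<And>z. z \<in> Z \<Longrightarrow> g z = 0"
  shows "right_act x g \<in> coradical"
proof (rule mem_subspaceI)
  show "subspace coradical"
    unfolding relative_socle_def by (rule subspace_span)
  fix f assume "functional f" "\<And>y. y \<in> coradical \<Longrightarrow> f y = 0"
  then have "left_act f x \<in> Z" "functional f"
    using assms(1) by (auto simp: coradical_annihilator_def)
  then show "f (right_act x g) = 0"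
    using assms(2,3) by (simp flip: functional_left_act)
qed

lemma exists_cover:
  assumes Z: "left_submodule Z" and L: "left_submodule L" "Z \<subset> L"
    and W: "subspace W" "W \<subseteq> span B" "finite B" "\<And>l. l \<in> L \<Longrightarrow> \<exists>z\<in>Z. \<exists>w\<in>W. l = z + w"
  obtains U where "covers Z U" "U \<subseteq> L"
proof -
  define F where "F = {U. left_submodule U \<and> Z \<subset> U \<and> U \<subseteq> L}"
  have "F \<noteq> {}"
    using L by (auto simp: F_def)
  then obtain U where U: "U \<in> F" "\<And>U'. U' \<in> F \<Longrightarrow> U' \<subseteq> U \<Longrightarrow> U' = U"
    using W by (elim minimal_subspace_over[of F Z W B]) (auto simp: F_def left_submodule_def)
  then have "L' = Z \<or> L' = U" if "left_submodule L'" "Z \<subseteq> L'" "L' \<subseteq> U" for L'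
    using that by (auto simp: F_def)
  then show thesis
    using U(1) Z by (intro that[of U]) (auto simp: F_def covers_def)
qed

text \<open>
  A simple submodule of a semisimple module has a complement: take \<open>R\<close> maximal with \<open>U \<inter> R = {0}\<close>. A
  simple submodule not contained in \<open>U + R\<close> would meet it trivially, and could be added to \<open>R\<close>.
\<close>

lemma simple_submodule_complement:
  assumes U: "covers {0} U"
  obtains R where "left_submodule R" "U \<inter> R = {0}"
    "\<forall>s\<in>coradical. \<exists>u\<in>U. \<exists>r\<in>R. s = u + r"
proof -
  define F where "F = {R. left_submodule R \<and> U \<inter> R = {0}}"
  have U': "left_submodule U" "0 \<in> U"
    using U by (auto simp: covers_def)
  have "\<exists>R\<in>F. \<forall>X\<in>F. R \<subseteq> X \<longrightarrow> X = R"
  proof (rule subset_Zorn_nonempty)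
    show "F \<noteq> {}"
      using U' left_submodule_0 by (auto simp: F_def)
    fix C assume C: "C \<noteq> {}" "subset.chain F C"
    have CF: "C \<subseteq> F" and tot: "\<And>X Y. X \<in> C \<Longrightarrow> Y \<in> C \<Longrightarrow> X \<subseteq> Y \<or> Y \<subseteq> X"
      using C(2) by (auto simp: subset_chain_def)
    have "x + y \<in> \<Union>C" if xy: "x \<in> \<Union>C" "y \<in> \<Union>C" for x y
    proof -
      obtain X Y where XY: "X \<in> C" "x \<in> X" "Y \<in> C" "y \<in> Y"
        using xy by blast
      have "\<exists>X\<in>C. x \<in> X \<and> y \<in> X"
        using tot[OF XY(1,3)] XY by blast
      then obtain X where "X \<in> C" "x \<in> X" "y \<in> X"
        by blast
      then have "subspace X"
        using CF by (auto simp: F_def left_submodule_def)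
      then have "x + y \<in> X"
        using \<open>x \<in> X\<close> \<open>y \<in> X\<close> by (rule subspace_add)
      then show ?thesis
        using \<open>X \<in> C\<close> by blast
    qed
    moreover have "0 \<in> \<Union>C"
      using C(1) CF by (auto simp: F_def)
    moreover have "scale c x \<in> \<Union>C" if x: "x \<in> \<Union>C" for c x
    proof -
      obtain X where "X \<in> C" "x \<in> X"
        using x by blast
      then have "subspace X"
        using CF by (auto simp: F_def left_submodule_def)
      then have "scale c x \<in> X"
        using \<open>x \<in> X\<close> by (rule subspace_scale)
      then show ?thesis
        using \<open>X \<in> C\<close> by blast
    qed
    ultimately have "subspace (\<Union>C)"
      by (simp add: subspace_def)
    moreover have "left_act f x \<in> \<Union>C" if "functional f" "x \<in> \<Union>C" for f x
      using that CF by (auto simp: F_def left_submodule_def)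
    ultimately have "left_submodule (\<Union>C)"
      unfolding left_submodule_def by blast
    moreover have "U \<inter> \<Union>C = {0}"
      using C(1) CF by (auto simp: F_def)
    ultimately show "\<Union>C \<in> F"
      by (simp add: F_def)
  qed
  then obtain R where R: "left_submodule R" "U \<inter> R = {0}"
    and max: "\<And>X. left_submodule X \<Longrightarrow> U \<inter> X = {0} \<Longrightarrow> R \<subseteq> X \<Longrightarrow> X = R"
    by (auto simp: F_def)
  define S where "S = {u + r |u r. u \<in> U \<and> r \<in> R}"
  have S: "left_submodule S"
    unfolding S_def using U'(1) R(1) by (rule left_submodule_sum)
  have 0: "0 \<in> R"
    using R by auto
  have "V \<subseteq> S" if V: "covers {0} V" for V
  proof (rule ccontr)
    assume nV: "\<not> V \<subseteq> S"
    have V': "left_submodule V" "0 \<in> V"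
      using V by (auto simp: covers_def)
    have "0 \<in> S"
      using S by (simp add: left_submodule_def subspace_0)
    then have VS: "V \<inter> S = {0}"
      using V nV left_submodule_Int[OF V'(1) S] by (auto simp: covers_def)
    define X where "X = {v + r |v r. v \<in> V \<and> r \<in> R}"
    have "left_submodule X"
      unfolding X_def using V'(1) R(1) by (rule left_submodule_sum)
    moreover have "U \<inter> X = {0}"
    proof -
      have "v + r = 0" if "v \<in> V" "r \<in> R" "v + r \<in> U" for v r
      proof -
        have "v = (v + r) + (- r)" "- r \<in> R"
          using that R(1) by (auto simp: left_submodule_def subspace_neg)
        then have "v \<in> S"
          using that(3) unfolding S_def by blast
        then have "v = 0"
          using VS that(1) by blast
        then show ?thesis
          using that R(2) by auto
      qed
      then have "U \<inter> X \<subseteq> {0}"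
        by (auto simp: X_def)
      moreover have "0 \<in> X"
        using \<open>left_submodule X\<close> by (simp add: left_submodule_def subspace_0)
      ultimately show ?thesis
        using U'(2) by blast
    qed
    moreover have "R \<subseteq> X"
      using V'(2) by (force simp: X_def)
    ultimately have "X = R"
      by (rule max)
    moreover have "V \<subseteq> X"
      using 0 by (force simp: X_def)
    moreover have "R \<subseteq> S"
      using U'(2) by (force simp: S_def)
    ultimately show False
      using nV by blast
  qed
  then have "coradical \<subseteq> S"
    unfolding relative_socle_def using S
    by (intro span_minimal) (auto simp: left_submodule_def subspace_0)
  then have "\<forall>s\<in>coradical. \<exists>u\<in>U. \<exists>r\<in>R. s = u + r"
    unfolding S_def by blast
  with R show thesis
    by (rule that)
qed

text \<open>
  With \<open>Q\<close> the relative socle and \<open>P = Z + C\<^sup>* \<cdot> x\<close>, choose a submodule \<open>L\<close> minimal among those with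
  \<open>Z \<subseteq> L \<subseteq> P\<close> and \<open>x \<in> L + Q\<close>; the goal is \<open>L = Z\<close>. Otherwise \<open>L\<close> contains a cover \<open>T\<close> of \<open>Z\<close>, and some
  right translation, by a functional \<open>g\<close> vanishing on \<open>Z\<close>, embeds \<open>T/Z\<close> into the coradical as a simple
  submodule with a complement \<open>R\<close>. The elements of \<open>L\<close> translated into \<open>R\<close> form a smaller submodule which,
  together with \<open>T \<subseteq> Q\<close>, still reaches \<open>x\<close>, against minimality.
\<close>

lemma mem_relative_socle:
  assumes Z: "left_submodule Z" and D: "left_submodule D" "Z \<subseteq> D" "x \<in> D"
    and ann: "\<And>f. f \<in> coradical_annihilator \<Longrightarrow> left_act f x \<in> Z"
  shows "x \<in> relative_socle D Z"
proof -
  define Q where "Q = relative_socle D Z"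
  define W where "W = {left_act f x |f. functional f}"
  define P where "P = {z + w |z w. z \<in> Z \<and> w \<in> W}"
  have W: "left_submodule W"
    unfolding W_def by (rule left_submodule_cyclic)
  obtain B where B: "finite B" "W \<subseteq> span B"
    unfolding W_def by (rule cyclic_finite_dimensional)
  have P: "left_submodule P"
    unfolding P_def using Z W by (rule left_submodule_sum)
  have Q: "left_submodule Q" "Z \<subseteq> Q"
    unfolding Q_def using Z by (auto intro: left_submodule_relative_socle subset_relative_socle[THEN subsetD])
  have "W \<subseteq> D"
    using D by (auto simp: W_def left_submodule_def)
  then have "P \<subseteq> D"
    using D by (auto simp: P_def left_submodule_def intro!: subspace_add)
  have "0 \<in> W" "0 \<in> Z" "0 \<in> Q"
    using W Z Q by (auto simp: left_submodule_def subspace_0)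
  have "x \<in> W"
    unfolding W_def by (rule mem_cyclic)
  then have "x \<in> P"
    using \<open>0 \<in> Z\<close> by (force simp: P_def)
  have "Z \<subseteq> P"
    using \<open>0 \<in> W\<close> by (force simp: P_def)
  define F where "F = {L. left_submodule L \<and> Z \<subseteq> L \<and> L \<subseteq> P \<and> (\<exists>l\<in>L. \<exists>q\<in>Q. x = l + q)}"
  have "\<exists>l\<in>P. \<exists>q\<in>Q. x = l + q"
    using \<open>x \<in> P\<close> \<open>0 \<in> Q\<close> by (intro bexI[of _ x] bexI[of _ 0]) auto
  then have "P \<in> F"
    using P \<open>Z \<subseteq> P\<close> by (simp add: F_def)
  then have "F \<noteq> {}"
    by blast
  have decomp: "\<exists>z\<in>Z. \<exists>w\<in>W. l = z + w" if "L \<in> F" "l \<in> L" for L l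
    using that unfolding F_def P_def by blast
  have "subspace W"
    using W by (simp add: left_submodule_def)
  obtain L where L: "L \<in> F" "\<And>L'. L' \<in> F \<Longrightarrow> L' \<subseteq> L \<Longrightarrow> L' = L"
  proof (rule minimal_subspace_over[OF \<open>F \<noteq> {}\<close> _ \<open>subspace W\<close> B(2,1)])
    show "subspace L \<and> Z \<subseteq> L \<and> (\<forall>l\<in>L. \<exists>z\<in>Z. \<exists>w\<in>W. l = z + w)" if "L \<in> F" for L
      using that decomp by (simp add: F_def left_submodule_def)
  qed (rule that)
  obtain l q where lq: "l \<in> L" "q \<in> Q" "x = l + q"
    using L(1) by (auto simp: F_def)
  have "L = Z"
  proof (rule ccontr)
    assume "L \<noteq> Z"
    then have "Z \<subset> L"
      using L(1) by (auto simp: F_def)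
    obtain T where T: "covers Z T" "T \<subseteq> L"
      using exists_cover[OF Z _ \<open>Z \<subset> L\<close> \<open>subspace W\<close> B(2,1) decomp[OF L(1)]] L(1)
      unfolding F_def by blast
    have "T \<subseteq> Q"
      unfolding Q_def using T L(1) \<open>P \<subseteq> D\<close>
      by (intro cover_subset_relative_socle) (auto simp: F_def)
    obtain t where t: "t \<in> T" "t \<notin> Z"
      using T(1) by (auto simp: covers_def)
    obtain g where g: "functional g" "\<And>z. z \<in> Z \<Longrightarrow> g z = 0" "g t \<noteq> 0"
      using separating_functional[of Z t] Z t by (auto simp: left_submodule_def)
    define T' where "T' = (\<lambda>u. right_act u g) ` T"
    have "counit (right_act t g) = g t"
      using functional_left_act[OF counit_linear g(1), of t] by (simp add: left_act_counit)
    then have "right_act t g \<noteq> 0"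
      using g(3) functional_0[OF counit_linear] by metis
    then have T': "covers {0} T'"
      using image_of_cover[OF T(1) g(1,2)] t(1) unfolding T'_def by blast
    obtain R where R: "left_submodule R" "T' \<inter> R = {0}"
      "\<forall>s\<in>coradical. \<exists>u\<in>T'. \<exists>r\<in>R. s = u + r"
      using T' by (rule simple_submodule_complement)
    define L' where "L' = {y \<in> L. right_act y g \<in> R}"
    have "right_act l g \<in> coradical"
    proof -
      obtain z f where zf: "z \<in> Z" "functional f" "l = z + left_act f x"
        using lq(1) L(1) by (auto simp: F_def P_def W_def)
      have "right_act x g \<in> coradical"
        using ann g(1,2) by (rule right_act_in_coradical)
      then have "left_act f (right_act x g) \<in> coradical"
        using left_submodule_relative_socle[OF left_submodule_0] zf(2) by (simp add: left_submodule_def)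
      then show ?thesis
        using zf g(1) right_act_eq_0[OF Z g(1,2) zf(1)] by (simp add: right_act_add left_act_right_act)
    qed
    then obtain u r where ur: "u \<in> T" "r \<in> R" "right_act l g = right_act u g + r"
      using R(3) by (auto simp: T'_def)
    have "l - u \<in> L"
      using ur(1) T(2) lq(1) L(1) by (auto simp: F_def left_submodule_def intro: subspace_diff)
    then have "l - u \<in> L'"
      using ur g(1) by (simp add: L'_def right_act_diff)
    moreover have "x = (l - u) + (u + q)" "u + q \<in> Q"
      using lq ur(1) \<open>T \<subseteq> Q\<close> Q(1) by (auto simp: left_submodule_def intro: subspace_add)
    moreover have "left_submodule L'"
      unfolding L'_def using L(1) R(1) g(1) by (intro left_submodule_vimage_right_act) (auto simp: F_def)
    moreover have "Z \<subseteq> L'"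
      using L(1) R(1) right_act_eq_0[OF Z g(1,2)]
      by (auto simp: L'_def F_def left_submodule_def subspace_0)
    moreover have "L' \<subseteq> L"
      by (auto simp: L'_def)
    ultimately have "L' \<in> F"
      using L(1) unfolding F_def by blast
    then have "L' = L"
      using \<open>L' \<subseteq> L\<close> by (rule L(2))
    then have "right_act t g \<in> T' \<inter> R"
      using t(1) T(2) by (auto simp: L'_def T'_def)
    then show False
      using R(2) \<open>right_act t g \<noteq> 0\<close> by blast
  qed
  then have "x \<in> Q"
    using lq Q by (auto simp: left_submodule_def intro: subspace_add)
  then show ?thesis
    by (simp add: Q_def)
qed

section \<open>The coradical filtration and socle series\<close>

text \<open>
  \<open>coradical_layer n\<close> is \<open>C\<^bsub>n-1\<^esub>\<close>, defined by iterated annihilation; \<open>socle_series_eq\<close> is the comparison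
  with the socle series.
\<close>

primrec coradical_layer :: "nat \<Rightarrow> 'c set" where
  "coradical_layer 0 = {0}"
| "coradical_layer (Suc n) = {x. \<forall>f\<in>coradical_annihilator. left_act f x \<in> coradical_layer n}"

lemma annihilator_functional: "f \<in> coradical_annihilator \<Longrightarrow> functional f"
  by (simp add: coradical_annihilator_def)

text \<open>
  The coradical is a left submodule, so its annihilator is closed under \<open>f \<mapsto> (y \<mapsto> f (h \<cdot> y))\<close>.
\<close>

lemma left_submodule_layer: "left_submodule (coradical_layer n)"
proof (induction n)
  case 0
  show ?case by (simp add: left_submodule_0)
next
  case (Suc n)
  have "subspace (coradical_layer (Suc n))"
    using Suc
    by (auto simp: subspace_def left_submodule_def annihilator_functional left_act_0 left_act_add
        left_act_scale)
  moreover have "left_act h x \<in> coradical_layer (Suc n)"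
    if h: "functional h" and x: "x \<in> coradical_layer (Suc n)" for h x
  proof -
    have "left_act f (left_act h x) \<in> coradical_layer n" if f: "f \<in> coradical_annihilator" for f
    proof -
      have "(\<lambda>y. f (left_act h y)) \<in> coradical_annihilator"
        using f h left_submodule_relative_socle[OF left_submodule_0]
        by (auto simp: coradical_annihilator_def left_submodule_def intro!: functional_comp linear_left_act)
      then show ?thesis
        using x f h by (simp add: left_act_left_act annihilator_functional)
    qed
    then show ?thesis by simp
  qed
  ultimately show ?case
    unfolding left_submodule_def by blast
qed

lemma right_act_layer: "functional g \<Longrightarrow> x \<in> coradical_layer n \<Longrightarrow> right_act x g \<in> coradical_layer n"
  by (induction n arbitrary: x) (auto simp: right_act_0 left_act_right_act annihilator_functional)

lemma layer_mono: "coradical_layer n \<subseteq> coradical_layer (Suc n)"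
  using left_submodule_layer[of n] by (auto simp: left_submodule_def annihilator_functional)

lemma relative_socle_layer:
  assumes D: "left_submodule D"
  shows "relative_socle D (D \<inter> coradical_layer n) = D \<inter> coradical_layer (Suc n)"
proof -
  let ?Z = "D \<inter> coradical_layer n"
  have Z: "left_submodule ?Z"
    using D left_submodule_layer by (rule left_submodule_Int)
  have "relative_socle D ?Z \<subseteq> D"
    unfolding relative_socle_def using D by (intro span_minimal) (auto simp: left_submodule_def)
  then show ?thesis
    using annihilator_relative_socle[OF Z] mem_relative_socle[OF Z D] D
    by (auto simp: left_submodule_def annihilator_functional)
qed

definition coset :: "'c set \<Rightarrow> 'c \<Rightarrow> 'c set" where
  "coset Z x = (\<lambda>z. z + x) ` Z"

text \<open>
  The submodule \<open>U/Z\<close> of \<open>C/Z\<close>. Replacing the carrier of \<open>quotient_submodule Z D\<close> by the image of \<open>U\<close>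
  gives \<open>quotient_submodule Z U\<close>, so a quotient and its submodules are handled uniformly.
\<close>

definition quotient_submodule :: "'c set \<Rightarrow> 'c set \<Rightarrow> ('c \<Rightarrow> 'k, 'c set) module" where
  "quotient_submodule Z U = (quotient_module dual_module Z)\<lparr>carrier := coset Z ` U\<rparr>"

lemma coset_eq_iff:
  assumes "left_submodule Z"
  shows "coset Z x = coset Z y \<longleftrightarrow> x - y \<in> Z"
proof
  have "0 \<in> Z"
    using assms by (simp add: left_submodule_def subspace_0)
  then have "x \<in> coset Z x"
    by (force simp: coset_def)
  then show "x - y \<in> Z" if "coset Z x = coset Z y"
    using that by (auto simp: coset_def)
next
  assume xy: "x - y \<in> Z"
  have "z + x \<in> coset Z y" if "z \<in> Z" for z
    using that xy assms subspace_add[of Z z "x - y"]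
    by (auto simp: coset_def left_submodule_def image_iff intro!: bexI[of _ "z + (x - y)"])
  moreover have "z + y \<in> coset Z x" if "z \<in> Z" for z
    using that xy assms subspace_diff[of Z z "x - y"]
    by (auto simp: coset_def left_submodule_def image_iff intro!: bexI[of _ "z - (x - y)"])
  ultimately show "coset Z x = coset Z y"
    by (auto simp: coset_def)
qed

lemma coset_0: "coset Z 0 = Z"
  by (simp add: coset_def)

lemma quotient_module_eq:
  "quotient_module (dual_module\<lparr>carrier := D\<rparr>) Z = quotient_submodule Z D"
  by (auto simp: quotient_module_def quotient_submodule_def dual_module_def A_RCOSETS_def RCOSETS_def
      a_r_coset_def r_coset_def set_add_def set_mult_def coset_def fun_eq_iff)

lemma quotient_submodule_simps:
  "carrier (quotient_submodule Z U) = coset Z ` U"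
  "\<zero>\<^bsub>quotient_submodule Z U\<^esub> = Z"
  "(quotient_submodule Z U)\<lparr>carrier := coset Z ` V\<rparr> = quotient_submodule Z V"
  by (simp_all add: quotient_submodule_def quotient_module_def)

lemma quotient_submodule_add:
  assumes "left_submodule Z"
  shows "coset Z x \<oplus>\<^bsub>quotient_submodule Z U\<^esub> coset Z y = coset Z (x + y)"
proof -
  have "z + x + (w + y) \<in> coset Z (x + y)" if "z \<in> Z" "w \<in> Z" for z w
    using that assms subspace_add[of Z z w]
    by (auto simp: coset_def left_submodule_def image_iff algebra_simps intro!: bexI[of _ "z + w"])
  moreover have "\<exists>u\<in>Z. \<exists>w\<in>Z. z + (x + y) = u + x + (w + y)" if "z \<in> Z" for z
    using that assms subspace_0[of Z]
    by (intro bexI[of _ z] bexI[of _ 0]) (auto simp: left_submodule_def algebra_simps)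
  ultimately show ?thesis
    by (auto simp: quotient_submodule_def quotient_module_def dual_module_def set_add_def set_mult_def
        coset_def)
qed

lemma quotient_submodule_smult:
  assumes "left_submodule Z" "functional f"
  shows "f \<odot>\<^bsub>quotient_submodule Z U\<^esub> coset Z x = coset Z (left_act f x)"
proof -
  have "f \<odot>\<^bsub>quotient_submodule Z U\<^esub> coset Z x = (\<Union>y\<in>coset Z x. coset Z (left_act f y))"
    by (auto simp: quotient_submodule_def quotient_module_def dual_module_def a_r_coset_def r_coset_def
        coset_def)
  moreover have "coset Z (left_act f y) = coset Z (left_act f x)" if "y \<in> coset Z x" for y
  proof -
    have "y - x \<in> Z"
      using that by (auto simp: coset_def)
    then have "left_act f (y - x) \<in> Z"
      using assms by (simp add: left_submodule_def)
    then show ?thesis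
      using assms by (simp add: coset_eq_iff left_act_diff)
  qed
  moreover have "coset Z x \<noteq> {}"
    using assms by (auto simp: coset_def left_submodule_def dest: subspace_0)
  ultimately show ?thesis
    by auto
qed

lemma quotient_submodule_group:
  assumes "left_submodule Z" "left_submodule U"
  shows "group (add_monoid (quotient_submodule Z U))"
proof (rule groupI)
  have U: "0 \<in> U" "\<And>x y. x \<in> U \<Longrightarrow> y \<in> U \<Longrightarrow> x + y \<in> U" "\<And>x. x \<in> U \<Longrightarrow> - x \<in> U"
    using assms(2) by (auto simp: left_submodule_def subspace_0 subspace_add subspace_neg)
  note simps = quotient_submodule_simps quotient_submodule_add[OF assms(1)]
  show "\<one>\<^bsub>add_monoid (quotient_submodule Z U)\<^esub> \<in> carrier (add_monoid (quotient_submodule Z U))"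
    using U(1) by (auto simp: simps image_iff coset_0 intro!: bexI[of _ 0])
  show "\<exists>y\<in>carrier (add_monoid (quotient_submodule Z U)).
      y \<otimes>\<^bsub>add_monoid (quotient_submodule Z U)\<^esub> X = \<one>\<^bsub>add_monoid (quotient_submodule Z U)\<^esub>"
    if X: "X \<in> carrier (add_monoid (quotient_submodule Z U))" for X
  proof -
    obtain x where "x \<in> U" "X = coset Z x"
      using X by (auto simp: simps)
    then show ?thesis
      using U(3)[of x] by (intro bexI[of _ "coset Z (- x)"]) (auto simp: simps coset_0)
  qed
  show "\<one>\<^bsub>add_monoid (quotient_submodule Z U)\<^esub> \<otimes>\<^bsub>add_monoid (quotient_submodule Z U)\<^esub> X = X"
    if "X \<in> carrier (add_monoid (quotient_submodule Z U))" for X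
    using that quotient_submodule_add[OF assms(1), where x = 0 and U = U] by (auto simp: simps coset_0)
qed (use assms in \<open>auto simp: quotient_submodule_simps quotient_submodule_add left_submodule_def
      subspace_add add.assoc\<close>)

lemma quotient_submodule_inv:
  assumes "left_submodule Z" "left_submodule U" "x \<in> U"
  shows "inv\<^bsub>add_monoid (quotient_submodule Z U)\<^esub> coset Z x = coset Z (- x)"
proof -
  interpret group "add_monoid (quotient_submodule Z U)"
    using assms(1,2) by (rule quotient_submodule_group)
  show ?thesis
    using assms
    by (intro inv_equality)
      (auto simp: quotient_submodule_simps quotient_submodule_add coset_0 left_submodule_def subspace_neg)
qed

text \<open>
  The correspondence theorem for submodules of a quotient. Scalar multiplication comes from the action
  of the multiples of the counit, which is why submodules are subspaces.
\<close>

lemma submodule_quotient_iff: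
  assumes Z: "left_submodule Z" and U: "left_submodule U" "Z \<subseteq> U"
  shows "submodule X dual_algebra (quotient_submodule Z U) \<longleftrightarrow>
    (\<exists>V. left_submodule V \<and> Z \<subseteq> V \<and> V \<subseteq> U \<and> X = coset Z ` V)"
proof
  assume "submodule X dual_algebra (quotient_submodule Z U)"
  then interpret X: submodule X dual_algebra "quotient_submodule Z U" .
  define V where "V = {x \<in> U. coset Z x \<in> X}"
  have XU: "X \<subseteq> coset Z ` U"
    using X.subset by (simp add: quotient_submodule_simps)
  have "coset Z x \<in> X" if "x \<in> Z" for x
  proof -
    have "coset Z x = coset Z 0"
      using that by (simp add: coset_eq_iff[OF Z])
    then show ?thesis
      using X.one_closed by (simp add: coset_0 quotient_submodule_simps)
  qed
  then have "Z \<subseteq> V"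
    using U(2) by (auto simp: V_def)
  moreover have "left_submodule V"
  proof -
    have act: "left_act f x \<in> V" if "functional f" "x \<in> V" for f x
      using that X.smult_closed[of f "coset Z x"] U(1)
      by (simp add: V_def quotient_submodule_smult[OF Z] dual_algebra_def left_submodule_def)
    have "x + y \<in> V" if "x \<in> V" "y \<in> V" for x y
      using that X.m_closed[of "coset Z x" "coset Z y"] U(1)
      by (simp add: V_def quotient_submodule_add[OF Z] left_submodule_def subspace_add)
    moreover have "scale c x \<in> V" if "x \<in> V" for c x
      using act[OF functional_scale[OF counit_linear, of c] that]
        left_act_scale_functional[OF counit_linear, of c x]
      by (simp add: left_act_counit)
    moreover have "0 \<in> V"
      using \<open>Z \<subseteq> V\<close> Z by (auto simp: left_submodule_def dest: subspace_0)
    ultimately show ?thesis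
      using act by (simp add: left_submodule_def subspace_def)
  qed
  moreover have "X = coset Z ` V"
    using XU by (auto simp: V_def)
  moreover have "V \<subseteq> U"
    by (auto simp: V_def)
  ultimately show "\<exists>V. left_submodule V \<and> Z \<subseteq> V \<and> V \<subseteq> U \<and> X = coset Z ` V"
    by blast
next
  assume "\<exists>V. left_submodule V \<and> Z \<subseteq> V \<and> V \<subseteq> U \<and> X = coset Z ` V"
  then obtain V where V: "left_submodule V" "Z \<subseteq> V" "V \<subseteq> U" and X: "X = coset Z ` V"
    by blast
  have V': "0 \<in> V" "\<And>x y. x \<in> V \<Longrightarrow> y \<in> V \<Longrightarrow> x + y \<in> V" "\<And>x. x \<in> V \<Longrightarrow> - x \<in> V"
    "\<And>f x. functional f \<Longrightarrow> x \<in> V \<Longrightarrow> left_act f x \<in> V"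
    using V(1) by (auto simp: left_submodule_def subspace_0 subspace_add subspace_neg)
  have "Z \<in> coset Z ` V"
    using V'(1) coset_0 by (metis imageI)
  moreover have "inv\<^bsub>add_monoid (quotient_submodule Z U)\<^esub> Y \<in> coset Z ` V" if "Y \<in> coset Z ` V" for Y
  proof -
    obtain x where "x \<in> V" "Y = coset Z x"
      using \<open>Y \<in> coset Z ` V\<close> by blast
    then show ?thesis
      using V'(3)[of x] V(3) quotient_submodule_inv[OF Z U(1), of x] by auto
  qed
  moreover have "Y \<oplus>\<^bsub>quotient_submodule Z U\<^esub> Y' \<in> coset Z ` V"
    if "Y \<in> coset Z ` V" "Y' \<in> coset Z ` V" for Y Y'
    using that V'(2) by (auto simp: quotient_submodule_add[OF Z])
  moreover have "f \<odot>\<^bsub>quotient_submodule Z U\<^esub> Y \<in> coset Z ` V"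
    if "f \<in> carrier dual_algebra" "Y \<in> coset Z ` V" for f Y
    using that V'(4) by (auto simp: dual_algebra_def quotient_submodule_smult[OF Z])
  ultimately show "submodule X dual_algebra (quotient_submodule Z U)"
    unfolding X using V(3)
    by (intro submodule.intro subgroup.intro submodule_axioms.intro)
      (auto simp: quotient_submodule_simps(1,2))
qed

lemma coset_image_eq_iff:
  assumes "left_submodule Z" "left_submodule V" "left_submodule W" "Z \<subseteq> V" "Z \<subseteq> W"
  shows "coset Z ` V = coset Z ` W \<longleftrightarrow> V = W"
proof -
  have "V \<subseteq> W" if sub: "coset Z ` V \<subseteq> coset Z ` W" "Z \<subseteq> W" "left_submodule W" for V W
  proof
    fix v assume "v \<in> V"
    then obtain w where "w \<in> W" "coset Z v = coset Z w"
      using sub(1) by blast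
    then have "w \<in> W" "v - w \<in> W"
      using sub(2) coset_eq_iff[OF assms(1)] by auto
    then have "(v - w) + w \<in> W"
      using sub(3) by (intro subspace_add) (auto simp: left_submodule_def)
    then show "v \<in> W" by simp
  qed
  then show ?thesis
    using assms by (metis subset_antisym subset_refl)
qed

lemma simple_quotient_iff:
  assumes Z: "left_submodule Z" and U: "left_submodule U" "Z \<subseteq> U"
  shows "simple_module dual_algebra (quotient_submodule Z U) \<longleftrightarrow> covers Z U"
proof -
  have Z1: "{Z} = coset Z ` Z"
  proof -
    have "coset Z z = coset Z 0" if "z \<in> Z" for z
      using that by (simp add: coset_eq_iff[OF Z])
    moreover have "0 \<in> Z"
      using Z by (simp add: left_submodule_def subspace_0)
    ultimately show ?thesis
      by (auto simp: coset_0)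
  qed
  have eq: "coset Z ` V = {Z} \<longleftrightarrow> V = Z" "coset Z ` V = coset Z ` U \<longleftrightarrow> V = U"
    if "left_submodule V" "Z \<subseteq> V" for V
    using coset_image_eq_iff[OF Z that(1) Z that(2) order_refl]
      coset_image_eq_iff[OF Z that(1) U(1) that(2) U(2)] Z1 by simp_all
  have "simple_module dual_algebra (quotient_submodule Z U) \<longleftrightarrow> coset Z ` U \<noteq> {Z} \<and>
      (\<forall>V. left_submodule V \<and> Z \<subseteq> V \<and> V \<subseteq> U \<longrightarrow> coset Z ` V = {Z} \<or> coset Z ` V = coset Z ` U)"
    unfolding simple_module_def quotient_submodule_simps submodule_quotient_iff[OF Z U] by blast
  also have "\<dots> \<longleftrightarrow> U \<noteq> Z \<and> (\<forall>V. left_submodule V \<and> Z \<subseteq> V \<and> V \<subseteq> U \<longrightarrow> V = Z \<or> V = U)"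
    by (simp add: eq U cong: imp_cong)
  also have "\<dots> \<longleftrightarrow> covers Z U"
    using Z U unfolding covers_def by blast
  finally show ?thesis .
qed

text \<open>
  \<open>socle\<close> generates only an additive subgroup; this agrees with the linear span because the union of
  the covers is closed under scalars.
\<close>

lemma socle_quotient:
  assumes Z: "left_submodule Z" and D: "left_submodule D" "Z \<subseteq> D"
  shows "{x \<in> D. coset Z x \<in> socle dual_algebra (quotient_submodule Z D)} = relative_socle D Z"
proof -
  let ?Q = "quotient_submodule Z D"
  define C where "C = \<Union>{U. covers Z U \<and> U \<subseteq> D}"
  have "{X. submodule X dual_algebra ?Q \<and> simple_module dual_algebra (?Q\<lparr>carrier := X\<rparr>)}
      = {coset Z ` U |U. covers Z U \<and> U \<subseteq> D}"
  proof -
    have "simple_module dual_algebra (?Q\<lparr>carrier := coset Z ` V\<rparr>) \<longleftrightarrow> covers Z V"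
      if "left_submodule V" "Z \<subseteq> V" for V
      using that simple_quotient_iff[OF Z] by (simp add: quotient_submodule_simps)
    moreover have "left_submodule V \<and> Z \<subseteq> V" if "covers Z V" for V
      using that by (auto simp: covers_def)
    ultimately show ?thesis
      unfolding submodule_quotient_iff[OF Z D] by blast
  qed
  then have "\<Union>{X. submodule X dual_algebra ?Q \<and> simple_module dual_algebra (?Q\<lparr>carrier := X\<rparr>)}
      = coset Z ` C"
    by (auto simp: C_def)
  then have soc: "socle dual_algebra ?Q = generate (add_monoid ?Q) (coset Z ` C)"
    by (simp add: socle_def)
  have C: "C \<subseteq> D" "\<And>c x. x \<in> C \<Longrightarrow> scale c x \<in> C"
    by (auto simp: C_def covers_def left_submodule_def subspace_scale)
  have rs: "relative_socle D Z = span (Z \<union> C)"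
    by (simp add: relative_socle_def C_def)
  have sub: "span (Z \<union> C) \<subseteq> D"
    using D C(1) by (intro span_minimal) (auto simp: left_submodule_def)
  have "coset Z x \<in> generate (add_monoid ?Q) (coset Z ` C)" if "x \<in> span (Z \<union> C)" for x
    using that
  proof (induction rule: span_induct_alt)
    case base
    then show ?case
      using generate.one[of "add_monoid ?Q" "coset Z ` C"] by (simp add: coset_0 quotient_submodule_simps)
  next
    case (step c x y)
    show ?case
    proof (cases "x \<in> Z")
      case True
      then have "coset Z (scale c x + y) = coset Z y"
        using Z by (simp add: coset_eq_iff left_submodule_def subspace_scale)
      with step show ?thesis by simp
    next
      case False
      then have "coset Z (scale c x) \<in> generate (add_monoid ?Q) (coset Z ` C)"
        using step(1) C(2) by (intro generate.incl) blast
      from generate.eng[OF this step(2)] show ?thesis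
        by (simp add: quotient_submodule_add[OF Z])
    qed
  qed
  moreover have gen: "\<exists>y\<in>span (Z \<union> C). X = coset Z y"
    if "X \<in> generate (add_monoid ?Q) (coset Z ` C)" for X
    using that
  proof induction
    case one
    then show ?case
      using span_zero by (auto simp: quotient_submodule_simps coset_0 intro!: bexI[of _ 0])
  next
    case (incl X)
    then show ?case
      using span_base by auto
  next
    case (inv X)
    then obtain y where "y \<in> C" "X = coset Z y"
      by blast
    then show ?case
      using C(1) by (intro bexI[of _ "- y"])
        (auto simp: quotient_submodule_inv[OF Z D(1)] intro!: span_neg intro: span_base)
  next
    case (eng X Y)
    then show ?case
      using span_add by (force simp: quotient_submodule_add[OF Z])
  qed
  have "x \<in> span (Z \<union> C)" if x: "coset Z x \<in> generate (add_monoid ?Q) (coset Z ` C)" for x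
  proof -
    obtain y where y: "y \<in> span (Z \<union> C)" "coset Z x = coset Z y"
      using gen[OF x] by blast
    then have "x - y \<in> Z"
      by (simp add: coset_eq_iff[OF Z])
    then have "(x - y) + y \<in> span (Z \<union> C)"
      using y(1) by (intro span_add) (auto intro: span_base)
    then show ?thesis by simp
  qed
  ultimately show ?thesis
    unfolding soc rs using sub by blast
qed

lemma socle_series_eq:
  assumes D: "left_submodule D"
  shows "socle_series dual_algebra (dual_module\<lparr>carrier := D\<rparr>) n = D \<inter> coradical_layer n"
proof (induction n)
  case 0
  then show ?case
    using D by (auto simp: dual_module_def left_submodule_def subspace_0)
next
  case (Suc n)
  let ?Z = "D \<inter> coradical_layer n"
  have Z: "left_submodule ?Z"
    using D left_submodule_layer by (rule left_submodule_Int)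
  have "?Z +>\<^bsub>dual_module\<lparr>carrier := D\<rparr>\<^esub> x = coset ?Z x" for x
    by (auto simp: a_r_coset_def r_coset_def coset_def dual_module_def)
  then have "socle_series dual_algebra (dual_module\<lparr>carrier := D\<rparr>) (Suc n)
      = {x \<in> D. coset ?Z x \<in> socle dual_algebra (quotient_submodule ?Z D)}"
    by (simp add: Suc quotient_module_eq)
  also have "\<dots> = D \<inter> coradical_layer (Suc n)"
    using socle_quotient[OF Z D] relative_socle_layer[OF D] by simp
  finally show ?case .
qed

section \<open>Loewy length and the wedge property\<close>

text \<open>
  The intersections of the finite-dimensional module \<open>C\<^sup>* \<cdot> x\<close> with the layers become stationary. Where
  they do, the relative socle is no larger than the intersection, which must then be all of
  \<open>C\<^sup>* \<cdot> x\<close>: a proper submodule of it has a cover inside it.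
\<close>

lemma exists_layer: "\<exists>n. x \<in> coradical_layer n"
proof -
  define W where "W = {left_act f x |f. functional f}"
  have W: "left_submodule W"
    unfolding W_def by (rule left_submodule_cyclic)
  obtain B where B: "finite B" "W \<subseteq> span B"
    unfolding W_def by (rule cyclic_finite_dimensional)
  have "dim (W \<inter> coradical_layer n) \<le> card B" for n
    using B by (intro dim_le_card) auto
  then obtain n where n: "\<And>m. dim (W \<inter> coradical_layer m) \<le> dim (W \<inter> coradical_layer n)"
    using ex_has_greatest_nat[of "\<lambda>n. True" 0 "\<lambda>n. dim (W \<inter> coradical_layer n)" "Suc (card B)"]
    by (auto simp: less_Suc_eq_le)
  let ?Z = "W \<inter> coradical_layer n"
  have Z: "left_submodule ?Z"
    using W left_submodule_layer by (rule left_submodule_Int)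
  have "\<not> ?Z \<subset> W \<inter> coradical_layer (Suc n)"
    using dim_psubset_of_finite_span[of ?Z "W \<inter> coradical_layer (Suc n)" B] n[of "Suc n"] Z B
    by (auto simp: left_submodule_def)
  then have stable: "relative_socle W ?Z = ?Z"
    using layer_mono[of n] by (auto simp: relative_socle_layer[OF W] simp del: coradical_layer.simps)
  have "\<not> ?Z \<subset> W"
  proof
    assume "?Z \<subset> W"
    moreover have "\<exists>z\<in>?Z. \<exists>w\<in>W. l = z + w" if "l \<in> W" for l
    proof -
      have "0 \<in> ?Z"
        using Z subspace_0[of ?Z] by (simp only: left_submodule_def)
      moreover have "l = 0 + l"
        by simp
      ultimately show ?thesis
        using that by blast
    qed
    ultimately obtain U where U: "covers ?Z U" "U \<subseteq> W"
      using exists_cover[OF Z W _ _ B(2,1)] W by (auto simp: left_submodule_def)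
    then show False
      using cover_subset_relative_socle[OF U] stable by (auto simp: covers_def)
  qed
  moreover have "x \<in> W"
    unfolding W_def by (rule mem_cyclic)
  ultimately show ?thesis
    by blast
qed

lemma left_submodule_generated_subcoalgebra: "left_submodule (generated_subcoalgebra x)"
  unfolding generated_subcoalgebra_def
proof (rule left_submodule_span)
  fix h u assume h: "functional h"
    and "u \<in> {left_act f (right_act x g) |f g. f \<in> carrier dual_algebra \<and> g \<in> carrier dual_algebra}"
  then obtain f g where fg: "functional f" "functional g" "u = left_act f (right_act x g)"
    by (auto simp: dual_algebra_def)
  have "left_act h u = left_act (\<lambda>y. h (left_act f y)) (right_act x g)"
    using h fg by (simp add: left_act_left_act)
  moreover have "functional (\<lambda>y. h (left_act f y))"
    using h linear_left_act[OF fg(1)] by (rule functional_comp)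
  ultimately show "left_act h u
      \<in> span {left_act f (right_act x g) |f g. f \<in> carrier dual_algebra \<and> g \<in> carrier dual_algebra}"
    using fg(2) by (intro span_base) (auto simp: dual_algebra_def)
qed

lemma mem_generated_subcoalgebra: "x \<in> generated_subcoalgebra x"
  unfolding generated_subcoalgebra_def
proof (rule span_base)
  have "x = left_act counit (right_act x counit)"
    by (simp add: left_act_counit right_act_counit)
  then show "x \<in> {left_act f (right_act x g) |f g. f \<in> carrier dual_algebra \<and> g \<in> carrier dual_algebra}"
    using counit_linear by (auto simp: dual_algebra_def)
qed

lemma generated_subcoalgebra_subset_layer:
  "generated_subcoalgebra x \<subseteq> coradical_layer n \<longleftrightarrow> x \<in> coradical_layer n"
proof
  assume x: "x \<in> coradical_layer n"
  show "generated_subcoalgebra x \<subseteq> coradical_layer n"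
    unfolding generated_subcoalgebra_def
  proof (rule span_minimal)
    show "{left_act f (right_act x g) |f g. f \<in> carrier dual_algebra \<and> g \<in> carrier dual_algebra}
        \<subseteq> coradical_layer n"
      using right_act_layer[OF _ x] left_submodule_layer[of n]
      by (auto simp: dual_algebra_def left_submodule_def)
    show "subspace (coradical_layer n)"
      using left_submodule_layer by (simp add: left_submodule_def)
  qed
qed (use mem_generated_subcoalgebra in blast)

text \<open>
  The layers are stable under both actions, so \<open>C\<^sup>* \<cdot> x \<cdot> C\<^sup>*\<close> lies in a layer as soon as \<open>x\<close> does. The
  least such layer exists, so the default value of \<open>LEAST\<close> never occurs.
\<close>

lemma lw_le_iff: "lw x \<le> n \<longleftrightarrow> x \<in> coradical_layer n"
proof -
  let ?D = "generated_subcoalgebra x"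
  have "socle_series dual_algebra (dual_module\<lparr>carrier := ?D\<rparr>) m = ?D \<longleftrightarrow> x \<in> coradical_layer m" for m
    unfolding socle_series_eq[OF left_submodule_generated_subcoalgebra]
    using generated_subcoalgebra_subset_layer[of x m] by blast
  then have lw: "lw x = (LEAST m. x \<in> coradical_layer m)"
    by (simp add: lw_def loewy_length_def)
  have "x \<in> coradical_layer (lw x)"
    unfolding lw using exists_layer by (rule LeastI_ex)
  moreover have "coradical_layer (lw x) \<subseteq> coradical_layer n" if "lw x \<le> n"
    using that layer_mono by (rule lift_Suc_mono_le[rotated])
  ultimately show ?thesis
    unfolding lw by (auto intro: Least_le)
qed

text \<open>
  The hypothesis is a coordinate-free form of \<open>\<Delta> x \<in> S p \<otimes> C + C \<otimes> S q\<close>, where \<open>S n\<close> is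
  \<open>coradical_layer n\<close>. It passes from \<open>x\<close> and \<open>q + 1\<close> to \<open>f \<cdot> x\<close> and \<open>q\<close> for \<open>f\<close> annihilating
  the coradical, since such an \<open>f\<close> maps \<open>S (q + 1)\<close> into \<open>S q\<close>.
\<close>

lemma wedge_of_layers:
  assumes "\<And>f. functional f \<Longrightarrow> (\<And>y. y \<in> coradical_layer q \<Longrightarrow> f y = 0) \<Longrightarrow> left_act f x \<in> coradical_layer p"
  shows "x \<in> coradical_layer (p + q)"
  using assms
proof (induction q arbitrary: x)
  case 0
  then show ?case
    using "0.prems"[OF counit_linear] functional_0[OF counit_linear]
    by (simp add: left_act_counit)
next
  case (Suc q)
  have "left_act f x \<in> coradical_layer (p + q)" if f: "f \<in> coradical_annihilator" for f
  proof (rule Suc.IH)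
    fix h assume h: "functional h" "\<And>y. y \<in> coradical_layer q \<Longrightarrow> h y = 0"
    have "left_act (\<lambda>y. h (left_act f y)) x \<in> coradical_layer p"
    proof (rule Suc.prems)
      show "functional (\<lambda>y. h (left_act f y))"
        using h(1) linear_left_act[OF annihilator_functional[OF f]] by (rule functional_comp)
      show "h (left_act f y) = 0" if "y \<in> coradical_layer (Suc q)" for y
        using that f h(2) by simp
    qed
    then show "left_act h (left_act f x) \<in> coradical_layer p"
      using f h(1) by (simp add: left_act_left_act annihilator_functional)
  qed
  then show ?case by simp
qed

lemma lw_le_of_comult:
  assumes D: "comult x = tensor2 scale (\<Sum>i\<in>I. pure2 (a i) (b i))"
    and ab: "\<And>i. i \<in> I \<Longrightarrow> lw (a i) \<le> p \<or> lw (b i) \<le> q"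
  shows "lw x \<le> p + q"
  unfolding lw_le_iff
proof (rule wedge_of_layers)
  fix f assume f: "functional f" "\<And>y. y \<in> coradical_layer q \<Longrightarrow> f y = 0"
  have sub: "subspace (coradical_layer p)"
    using left_submodule_layer by (simp add: left_submodule_def)
  have "scale (f (b i)) (a i) \<in> coradical_layer p" if "i \<in> I" for i
    using ab[OF that] unfolding lw_le_iff
  proof
    assume "b i \<in> coradical_layer q"
    then show ?thesis
      using f(2) sub by (simp add: subspace_0)
  qed (use sub in \<open>simp add: subspace_scale\<close>)
  then show "left_act f x \<in> coradical_layer p"
    using sub by (simp add: left_act_eq_sum[OF f(1) D] subspace_sum)
qed

end

theorem proposition1p1:
  fixes scale :: "'k::field \<Rightarrow> 'c::ab_group_add \<Rightarrow> 'c"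
    and comult :: "'c \<Rightarrow> (('c \<times> 'c) \<Rightarrow>\<^sub>0 'k) set"
    and counit :: "'c \<Rightarrow> 'k"
    and x :: 'c and n t :: nat and a b :: "nat \<Rightarrow> 'c"
  assumes "coalgebra scale comult counit"
    and "coalgebra.lw scale comult counit x > n"
    and "comult x = tensor2 scale (\<Sum>i=1..t. pure2 (a i) (b i))"
  shows "\<forall>k. 1 \<le> k \<and> k \<le> n \<longrightarrow>
    (\<exists>i\<in>{1..t}. coalgebra.lw scale comult counit (a i) \<ge> k \<and>
                coalgebra.lw scale comult counit (b i) \<ge> n - k)"
proof (intro allI impI)
  interpret coalgebra scale comult counit by (rule assms(1))
  fix k assume k: "1 \<le> k \<and> k \<le> n"
  show "\<exists>i\<in>{1..t}. k \<le> lw (a i) \<and> n - k \<le> lw (b i)"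
  proof (rule ccontr)
    assume none: "\<not> ?thesis"
    \<comment> \<open>For \<open>k = n\<close> the truncated difference \<open>n - k - 1\<close> is \<open>0\<close>; the first alternative then holds.\<close>
    have "lw (a i) \<le> k - 1 \<or> lw (b i) \<le> n - k - 1" if i: "i \<in> {1..t}" for i
    proof -
      have "\<not> (k \<le> lw (a i) \<and> n - k \<le> lw (b i))"
        using none i by blast
      then show ?thesis
        by linarith
    qed
    then have "lw x \<le> (k - 1) + (n - k - 1)"
      by (rule lw_le_of_comult[OF assms(3)])
    with assms(2) k show False
      by linarith
  qed
qed

end
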